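(* If a probability measure $\mu$ on $\mathbb R$ is the weak limit, as $n\to\infty$, of probability measures $$D_{b_n}(\mu_1\rhd\cdots\rhd\mu_n),$$ where $b_n$ ($n\ge1$) are positive real numbers and $\mu_n$ ($n\ge 1$) are probability measures on $\mathbb R$ such that $\{D_{b_n}(\mu_k)\}_{1\le k\le n,\,1\le n}$ forms an infinitesimal array, then $\mu$ is monotonically selfdecomposable. Conversely, any monotonically selfdecomposable probability measure on $\mathbb R$ can be obtained as such a limit.
   Context: $\mathbb{C}^+=\{z\in\mathbb{C}:\operatorname{Im} z>0\}$. For a probability measure $\mu$ on $\mathbb{R}$, $G_\mu(z)=\int_{\mathbb R}\frac{1}{z-x}\mu(dx)$ and $F_\mu(z)=1/G_\mu(z)$ for $z\in\mathbb C^+$; $F_\mu$ maps $\mathbb C^+$ to $\mathbb C^+$. The monotone convolution $\mu\rhd\nu$ is the probability measure on $\mathbb R$ with $F_{\mu\rhd\nu}=F_\mu\circ F_\nu$. For $c>0$, $D_c\mu$ is the dilation $(D_c\mu)(A)=\mu(A/c)$ for Borel $A\subset\mathbb R$. A probability measure $\mu$ on $\mathbb R$ is monotonically selfdecomposable if for every $c\in(0,1)$ there exists a probability measure $\overline\mu^c$ on $\mathbb R$ with $\mu=(D_c\mu)\rhd\overline\mu^c$. A family $\{\mu_{n,j}\}_{1\le j\le k_n,\,1\le n}$ of probability measures on $\mathbb R$ is an infinitesimal array if $k_n\to\infty$ as $n\to\infty$ and for every $\delta>0$, $\lim_{n\to\infty}\sup_{1\le j\le k_n}\mu_{n,j}(\mathbb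 R\setminus[-\delta,\delta])=0$ (here $k_n=n$). *)

theory Defs
  imports "HOL-Probability.Probability"
begin

text \<open>Probability measures on the real line are rendered by \<^locale>\<open>real_distribution\<close>,
  i.e. probability measures on the Borel sets of the reals.\<close>

definition upper_half_plane :: "complex set" where
  "upper_half_plane = {z. Im z > 0}"

definition cauchy_transform :: "real measure \<Rightarrow> complex \<Rightarrow> complex" where
  "cauchy_transform \<mu> z = (LINT x|\<mu>. 1 / (z - complex_of_real x))"

definition F_transform :: "real measure \<Rightarrow> complex \<Rightarrow> complex" where
  "F_transform \<mu> z = 1 / cauchy_transform \<mu> z"

text \<open>The description is proper for probability measures on the reals: the composition of two
  reciprocal Cauchy transforms is again one (Nevanlinna representation), and a probability measure
  is determined by its Cauchy transform (Stieltjes inversion).\<close>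

definition monotone_conv :: "real measure \<Rightarrow> real measure \<Rightarrow> real measure"  (infixl \<open>\<rhd>\<close> 70) where
  "\<mu> \<rhd> \<nu> = (THE \<rho>. real_distribution \<rho> \<and>
     (\<forall>z\<in>upper_half_plane. F_transform \<rho> z = F_transform \<mu> (F_transform \<nu> z)))"

text \<open>\<open>monotone_conv_upto \<mu> n\<close> is $\mu_1 \rhd \cdots \rhd \mu_n$, bracketed to the left. The index
  \<open>0\<close> is outside the range of interest; there we take the empty convolution, the point mass at
  zero.\<close>

fun monotone_conv_upto :: "(nat \<Rightarrow> real measure) \<Rightarrow> nat \<Rightarrow> real measure" where
  "monotone_conv_upto \<mu> 0 = return borel 0"
| "monotone_conv_upto \<mu> (Suc 0) = \<mu> 1"
| "monotone_conv_upto \<mu> (Suc (Suc n)) = monotone_conv_upto \<mu> (Suc n) \<rhd> \<mu> (Suc (Suc n))"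

definition dilation :: "real \<Rightarrow> real measure \<Rightarrow> real measure" where
  "dilation c \<mu> = distr \<mu> borel (\<lambda>x. c * x)"

lemma emeasure_dilation:
  assumes "real_distribution \<mu>" and "c > 0" and "A \<in> sets borel"
  shows "emeasure (dilation c \<mu>) A = emeasure \<mu> ((\<lambda>x. x / c) ` A)"
proof -
  interpret real_distribution \<mu> by fact
  have "(\<lambda>x. c * x) -` A \<inter> space \<mu> = (\<lambda>x. x / c) ` A"
    using assms(2) by (force simp: image_iff)
  then show ?thesis
    unfolding dilation_def using assms(3) by (subst emeasure_distr) auto
qed

definition monotonically_selfdecomposable :: "real measure \<Rightarrow> bool" where
  "monotonically_selfdecomposable \<mu> \<longleftrightarrow> real_distribution \<mu> \<and>
     (\<forall>c. 0 < c \<and> c < 1 \<longrightarrow> (\<exists>\<nu>. real_distribution \<nu> \<and> \<mu> = dilation c \<mu> \<rhd> \<nu>))"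

text \<open>Both indices start at \<open>1\<close>.  The supremum over an empty row (\<open>k n = 0\<close>) is unspecified, but
  this can occur only for finitely many \<open>n\<close>.\<close>

definition infinitesimal_array :: "(nat \<Rightarrow> nat) \<Rightarrow> (nat \<Rightarrow> nat \<Rightarrow> real measure) \<Rightarrow> bool" where
  "infinitesimal_array k M \<longleftrightarrow>
     (\<forall>n\<ge>1. \<forall>j\<in>{1..k n}. real_distribution (M n j)) \<and>
     filterlim k at_top sequentially \<and>
     (\<forall>\<delta>>0. (\<lambda>n. SUP j\<in>{1..k n}. measure (M n j) (UNIV - {-\<delta>..\<delta>})) \<longlonglongrightarrow> 0)"

end

theory Submission
  imports Defs "HOL-Computational_Algebra.Fundamental_Theorem_Algebra"
begin

text \<open>A monotone convolution exists because \<open>F\<^sub>\<mu> \<circ> F\<^sub>\<nu>\<close> can be realised by partial fractions when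
  \<open>\<mu>\<close> and \<open>\<nu>\<close> are finitely supported; a tightness argument passes to the limit, and Stieltjes inversion
  gives uniqueness.

  For a limit law \<open>\<mu> \<noteq> \<delta>\<^sub>0\<close> infinitesimality forces \<open>b\<^sub>n \<rightarrow> 0\<close> and \<open>b\<^sub>n\<^sub>+\<^sub>1 / b\<^sub>n \<rightarrow> 1\<close>, so some
  \<open>m\<^sub>n \<rightarrow> \<infinity>\<close> satisfies \<open>b\<^sub>n / b\<^bsub>m\<^sub>n\<^esub> \<rightarrow> c\<close>.  Cutting the \<open>n\<close>-fold convolution after the factor \<open>m\<^sub>n\<close>
  gives left parts that converge to \<open>D\<^sub>c \<mu>\<close>; the right parts are tight, because \<open>F\<close>-transforms are
  close to the identity far up in the half-plane, and every limit point is a cofactor of \<open>D\<^sub>c \<mu>\<close>.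

  Conversely, with \<open>b\<^sub>n = 1 / n\<close> the cofactors for \<open>c = (n - 1) / n\<close>, dilated by \<open>n\<close>, telescope to
  \<open>D\<^sub>n \<mu>\<close>; the array is infinitesimal since the cofactors tend to \<open>\<delta>\<^sub>0\<close> as \<open>c \<rightarrow> 1\<close>.\<close>

subsection \<open>The Cauchy transform\<close>

text \<open>Two elementary facts carry the analysis. Nonnegativity of a variance gives
  \<open>Im (F z) \<ge> Im z\<close>, so applying a right factor never lowers the height at which an
  estimate for the left factor is used. On the imaginary axis, Re (iy G(iy)) is the integral of y^2
  / (x^2 + y^2). A Markov inequality turns this into a tail bound, so tightness and convergence to
  the point mass at 0 can be read off from G at a single point; and since the integral increases
  with y while dilation rescales y, it also detects the scale of a law. The obstacle in both
  directions is to cancel a left factor: from F_S = F_L o F_N, information about F_N must be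
  recovered although F_L need not be injective. High up in the half-plane F_L can be inverted
  approximately, uniformly over all laws with a common tail bound. Hence the estimates take a
  cut-off \<open>K\<close> and a tail mass \<open>e\<close> instead of a fixed law. The recurring
  threshold 1/12 makes 6 e at most 1/2, which keeps the normalised difference quotient of G away
  from 0.\<close>

lemma upper_half_plane_iff [simp]: "z \<in> upper_half_plane \<longleftrightarrow> Im z > 0"
  by (simp add: upper_half_plane_def)

lemma Im_le_norm_diff_of_real: "Im z \<le> norm (z - complex_of_real x)"
  using abs_Im_le_cmod[of "z - complex_of_real x"] by simp

lemma diff_of_real_nonzero [simp]:
  assumes "Im z > 0" shows "z - complex_of_real x \<noteq> 0" "z \<noteq> complex_of_real x"
  using assms by (auto simp: complex_eq_iff)

lemma norm_cauchy_kernel_le: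
  assumes "Im z > 0" shows "norm (1 / (z - complex_of_real x)) \<le> 1 / Im z"
  using Im_le_norm_diff_of_real[of z x] assms
  by (auto simp: norm_divide intro!: divide_left_mono mult_pos_pos)

lemma norm_of_real_over_diff_le:
  assumes "Im z > 0" shows "norm (complex_of_real x / (z - complex_of_real x)) \<le> \<bar>x\<bar> / Im z"
  using mult_left_mono[OF norm_cauchy_kernel_le[OF assms, of x] abs_ge_zero[of x]]
  by (simp add: norm_divide)

lemma norm_over_diff_of_real_le:
  assumes "Im z > 0" shows "norm (z / (z - complex_of_real x)) \<le> norm z / Im z"
  using mult_left_mono[OF norm_cauchy_kernel_le[OF assms, of x] norm_ge_zero[of z]]
  by (simp add: norm_divide)

lemma cauchy_kernel_shift:
  assumes "Im z > 0"
  shows "z / (z - complex_of_real x) = 1 + complex_of_real x / (z - complex_of_real x)"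
  using diff_of_real_nonzero[OF assms, of x] by (simp add: field_simps)

lemma Im_cauchy_kernel:
  "Im (1 / (z - complex_of_real x)) = - Im z / (norm (z - complex_of_real x))\<^sup>2"
  by (simp add: Im_divide cmod_power2)

lemma Re_ii_cauchy_kernel:
  assumes "y > 0"
  shows "Re (\<i> * complex_of_real y * (1 / (\<i> * complex_of_real y - complex_of_real x)))
    = y\<^sup>2 / (x\<^sup>2 + y\<^sup>2)"
  by (simp add: Re_divide power2_eq_square)

context real_distribution
begin

lemma integrable_cauchy_kernel:
  assumes "Im z > 0" shows "integrable M (\<lambda>x. 1 / (z - complex_of_real x))"
  by (rule integrable_const_bound[where B = "1 / Im z"])
     (use norm_cauchy_kernel_le[OF assms] in auto)

lemma Im_cauchy_transform:
  assumes "Im z > 0"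
  shows "Im (cauchy_transform M z) = - Im z * (\<integral>x. 1 / (norm (z - complex_of_real x))\<^sup>2 \<partial>M)"
proof -
  have "Im (cauchy_transform M z) = (\<integral>x. Im (1 / (z - complex_of_real x)) \<partial>M)"
    unfolding cauchy_transform_def by (rule integral_Im[symmetric, OF integrable_cauchy_kernel[OF assms]])
  also have "\<dots> = (\<integral>x. - Im z * (1 / (norm (z - complex_of_real x))\<^sup>2) \<partial>M)"
    unfolding Im_cauchy_kernel by simp
  finally show ?thesis by (simp only: integral_mult_right_zero)
qed

lemma integrable_cauchy_kernel_sq:
  assumes "Im z > 0" shows "integrable M (\<lambda>x. 1 / (norm (z - complex_of_real x))\<^sup>2)"
proof (rule integrable_const_bound[where B = "(1 / Im z)\<^sup>2"])
  show "AE x in M. norm (1 / (norm (z - complex_of_real x))\<^sup>2) \<le> (1 / Im z)\<^sup>2"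
    using power_mono[OF norm_cauchy_kernel_le[OF assms], of _ 2]
    by (auto simp: norm_divide power_divide)
qed auto

text \<open>The variance of |1 / (z - x)| is nonnegative, and its second moment is - Im G / Im z.
  Dividing by |G|^2 turns this into \<open>Im (F z) \<ge> Im z\<close>.\<close>

lemma norm_cauchy_transform_sq_le:
  assumes "Im z > 0"
  shows "(norm (cauchy_transform M z))\<^sup>2 \<le> - Im (cauchy_transform M z) / Im z"
proof -
  let ?X = "\<lambda>x. norm (1 / (z - complex_of_real x))"
  have int: "integrable M ?X" "integrable M (\<lambda>x. (?X x)\<^sup>2)"
    using integrable_norm[OF integrable_cauchy_kernel[OF assms]] integrable_cauchy_kernel_sq[OF assms]
    by (auto simp: norm_divide power_divide)
  have "norm (cauchy_transform M z) \<le> expectation ?X"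
    unfolding cauchy_transform_def by (rule integral_norm_bound)
  then have "(norm (cauchy_transform M z))\<^sup>2 \<le> (expectation ?X)\<^sup>2"
    by (intro power_mono) auto
  also have "\<dots> \<le> expectation (\<lambda>x. (?X x)\<^sup>2)"
    using variance_positive[of ?X] variance_eq[OF int] by simp
  also have "\<dots> = - Im (cauchy_transform M z) / Im z"
    using assms by (simp add: Im_cauchy_transform norm_divide power_divide)
  finally show ?thesis .
qed

lemma Im_cauchy_transform_neg:
  assumes "Im z > 0" shows "Im (cauchy_transform M z) < 0"
proof -
  have "(\<integral>x. 1 / (norm (z - complex_of_real x))\<^sup>2 \<partial>M) > (\<integral>x. 0 \<partial>M)"
    by (rule integral_less_AE_space[OF _ integrable_cauchy_kernel_sq[OF assms]])
       (use assms in \<open>auto simp: emeasure_space_1[simplified]\<close>)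
  then show ?thesis using assms by (simp add: Im_cauchy_transform)
qed

lemma cauchy_transform_nonzero:
  assumes "Im z > 0" shows "cauchy_transform M z \<noteq> 0"
  using Im_cauchy_transform_neg[OF assms] by auto

lemma Im_F_transform_ge:
  assumes "Im z > 0" shows "Im (F_transform M z) \<ge> Im z"
proof -
  let ?G = "cauchy_transform M z"
  have "(norm ?G)\<^sup>2 > 0" using cauchy_transform_nonzero[OF assms] by simp
  moreover have "(norm ?G)\<^sup>2 * Im z \<le> - Im ?G"
    using norm_cauchy_transform_sq_le[OF assms] assms by (simp add: field_simps)
  ultimately have "Im z \<le> - Im ?G / (norm ?G)\<^sup>2" by (simp add: field_simps)
  then show ?thesis by (simp add: F_transform_def Im_divide cmod_power2)
qed

lemma Im_F_transform_pos:
  assumes "Im z > 0" shows "Im (F_transform M z) > 0"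
  using Im_F_transform_ge[OF assms] assms by simp

text \<open>The resolvent identity. Up to sign, the integral is the difference quotient of G: an
  upper bound for it gives a Lipschitz constant that is the same for all laws, a lower bound makes G
  quantitatively injective.\<close>

lemma cauchy_transform_diff:
  assumes "Im z > 0" "Im w > 0"
  shows "cauchy_transform M w - cauchy_transform M z =
    (z - w) * (\<integral>x. 1 / ((w - complex_of_real x) * (z - complex_of_real x)) \<partial>M)"
proof -
  have "cauchy_transform M w - cauchy_transform M z =
    (\<integral>x. 1 / (w - complex_of_real x) - 1 / (z - complex_of_real x) \<partial>M)"
    unfolding cauchy_transform_def
    by (rule Bochner_Integration.integral_diff[symmetric]) (intro integrable_cauchy_kernel assms)+
  also have "\<dots> = (\<integral>x. (z - w) * (1 / ((w - complex_of_real x) * (z - complex_of_real x))) \<partial>M)"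
    using diff_of_real_nonzero[OF assms(1)] diff_of_real_nonzero[OF assms(2)]
    by (intro Bochner_Integration.integral_cong) (auto simp: field_simps)
  finally show ?thesis by (simp only: integral_mult_right_zero)
qed

lemma norm_cauchy_kernel_prod_le:
  assumes "Im z > 0" "Im w > 0"
  shows "norm (1 / ((w - complex_of_real x) * (z - complex_of_real x))) \<le> 1 / (Im w * Im z)"
  using mult_mono[OF norm_cauchy_kernel_le[OF assms(2)] norm_cauchy_kernel_le[OF assms(1)], of x x] assms
  by (simp add: norm_mult norm_divide)

lemma integrable_cauchy_kernel_prod:
  assumes "Im z > 0" "Im w > 0"
  shows "integrable M (\<lambda>x. 1 / ((w - complex_of_real x) * (z - complex_of_real x)))"
  by (rule integrable_const_bound[where B = "1 / (Im w * Im z)"])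
     (use norm_cauchy_kernel_prod_le[OF assms] in auto)

lemma cauchy_transform_lipschitz:
  assumes "Im z > 0" "Im w > 0"
  shows "norm (cauchy_transform M w - cauchy_transform M z) \<le> norm (w - z) / (Im w * Im z)"
proof -
  let ?k = "\<lambda>x. 1 / ((w - complex_of_real x) * (z - complex_of_real x))"
  have "norm (\<integral>x. ?k x \<partial>M) \<le> (\<integral>x. norm (?k x) \<partial>M)" by (rule integral_norm_bound)
  also have "\<dots> \<le> 1 / (Im w * Im z)"
    using norm_cauchy_kernel_prod_le[OF assms] integrable_norm[OF integrable_cauchy_kernel_prod[OF assms]]
    by (intro integral_le_const) auto
  finally have "norm (z - w) * norm (\<integral>x. ?k x \<partial>M) \<le> norm (z - w) * (1 / (Im w * Im z))"
    by (intro mult_left_mono) auto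
  then show ?thesis
    unfolding cauchy_transform_diff[OF assms] by (simp add: norm_mult norm_minus_commute)
qed

text \<open>w G(w) - 1 is the integral of x / (w - x) = w / (w - x) - 1. The first form is small
  where |x| \<le> \<open>K\<close>, the second is bounded elsewhere, where the mass is at most
  \<open>e\<close>. The law enters only through \<open>K\<close> and \<open>e\<close>.\<close>

lemma norm_mult_cauchy_transform_le:
  assumes "Im w > 0" "K \<ge> 0" "e \<ge> 0" and tail: "measure M {x. K < \<bar>x\<bar>} \<le> e"
  shows "norm (w * cauchy_transform M w - 1) \<le> K / Im w + e * (1 + norm w / Im w)"
proof -
  let ?A = "{x::real. K < \<bar>x\<bar>}"
  let ?C = "1 + norm w / Im w"
  let ?f = "\<lambda>x. complex_of_real x / (w - complex_of_real x)"
  have A: "?A \<in> sets borel" by measurable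
  have eq: "?f x = w * (1 / (w - complex_of_real x)) - 1" for x
    using cauchy_kernel_shift[OF assms(1), of x] by simp
  have int: "integrable M ?f"
    unfolding eq
    by (intro Bochner_Integration.integrable_diff integrable_mult_right integrable_cauchy_kernel assms) simp
  have "norm (?f x) \<le> K / Im w + ?C * indicator ?A x" for x
  proof (cases "x \<in> ?A")
    case True
    have "?f x = w / (w - complex_of_real x) - 1" using eq[of x] by simp
    also have "norm \<dots> \<le> norm w / Im w + 1"
      using norm_triangle_ineq4[of "w / (w - complex_of_real x)" 1] norm_over_diff_of_real_le[OF assms(1), of x]
      by simp
    moreover have "0 \<le> K / Im w" using assms by simp
    ultimately show ?thesis using True by simp
  next
    case False
    then have "\<bar>x\<bar> / Im w \<le> K / Im w" using assms by (intro divide_right_mono) auto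
    then show ?thesis using norm_of_real_over_diff_le[OF assms(1), of x] False by simp
  qed
  then have "(\<integral>x. norm (?f x) \<partial>M) \<le> (\<integral>x. K / Im w + ?C * indicator ?A x \<partial>M)"
    using A int by (intro integral_mono) (auto simp: integrable_indicator_iff emeasure_eq_measure)
  also have "\<dots> = K / Im w + ?C * measure M ?A"
    using A by (subst Bochner_Integration.integral_add) (auto simp: prob_space integrable_indicator_iff emeasure_eq_measure prob_space[simplified])
  also have "\<dots> \<le> K / Im w + ?C * e"
    using tail assms by (intro add_left_mono mult_left_mono) auto
  finally have *: "(\<integral>x. norm (?f x) \<partial>M) \<le> K / Im w + ?C * e" .
  have "w * cauchy_transform M w - 1 = (\<integral>x. ?f x \<partial>M)"
    unfolding eq cauchy_transform_def
    by (subst Bochner_Integration.integral_diff)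
       (intro integrable_mult_right integrable_cauchy_kernel assms integrable_const
         | simp only: integral_mult_right_zero lebesgue_integral_const prob_space scaleR_one)+
  then have "norm (w * cauchy_transform M w - 1) \<le> (\<integral>x. norm (?f x) \<partial>M)"
    by (simp only: integral_norm_bound)
  then show ?thesis using * by (simp add: mult.commute)
qed

lemma integrable_sq_over_sum:
  assumes "y > 0" shows "integrable M (\<lambda>x. y\<^sup>2 / (x\<^sup>2 + y\<^sup>2))"
  by (rule integrable_const_bound[where B = 1])
     (use assms in \<open>auto intro!: AE_I2 divide_le_eq_1_pos[THEN iffD2] add_nonneg_pos\<close>)

lemma Re_ii_cauchy_transform:
  assumes "y > 0"
  shows "Re (\<i> * complex_of_real y * cauchy_transform M (\<i> * complex_of_real y))
    = (\<integral>x. y\<^sup>2 / (x\<^sup>2 + y\<^sup>2) \<partial>M)"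
proof -
  let ?z = "\<i> * complex_of_real y"
  have i: "integrable M (\<lambda>x. 1 / (?z - complex_of_real x))"
    using assms by (intro integrable_cauchy_kernel) auto
  have "?z * cauchy_transform M ?z = (\<integral>x. ?z * (1 / (?z - complex_of_real x)) \<partial>M)"
    unfolding cauchy_transform_def by (simp only: integral_mult_right_zero)
  also have "Re \<dots> = (\<integral>x. Re (?z * (1 / (?z - complex_of_real x))) \<partial>M)"
    using i by (intro integral_Re[symmetric] integrable_mult_right) auto
  finally show ?thesis unfolding Re_ii_cauchy_kernel[OF assms] .
qed

text \<open>Markov's inequality for x^2 / (x^2 + y^2), which is at least d^2 / (d^2 + y^2) when |x|
  > \<open>d\<close>. For \<open>d = y\<close> the constant is 2, the choice that yields tightness;
  a fixed \<open>y\<close> and arbitrary \<open>d\<close> yield convergence to the point mass at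
  0.\<close>

lemma measure_tail_le:
  assumes "y > 0" "d > 0"
  shows "measure M {x. d < \<bar>x\<bar>} \<le>
    (1 + y\<^sup>2 / d\<^sup>2) * (1 - Re (\<i> * complex_of_real y * cauchy_transform M (\<i> * complex_of_real y)))"
proof -
  let ?A = "{x::real. d < \<bar>x\<bar>}"
  have A: "?A \<in> sets borel" by measurable
  let ?C = "1 + y\<^sup>2 / d\<^sup>2"
  have "indicator ?A x \<le> ?C * (1 - y\<^sup>2 / (x\<^sup>2 + y\<^sup>2))" for x
  proof (cases "x \<in> ?A")
    case True
    then have "d\<^sup>2 \<le> x\<^sup>2" using assms by (simp add: abs_le_square_iff[symmetric])
    have p: "x\<^sup>2 + y\<^sup>2 > 0" using assms by (simp add: add_nonneg_pos)
    have "1 - y\<^sup>2 / (x\<^sup>2 + y\<^sup>2) = x\<^sup>2 / (x\<^sup>2 + y\<^sup>2)" using p by (metis add_diff_cancel_right' diff_divide_distrib divide_self less_irrefl)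
    moreover have "?C = (d\<^sup>2 + y\<^sup>2) / d\<^sup>2" using assms by (simp add: field_simps)
    moreover have "(d\<^sup>2 + y\<^sup>2) * x\<^sup>2 \<ge> d\<^sup>2 * (x\<^sup>2 + y\<^sup>2)"
      using mult_right_mono[OF \<open>d\<^sup>2 \<le> x\<^sup>2\<close>, of "y\<^sup>2"] by (simp add: algebra_simps)
    moreover have "0 < d\<^sup>2 * (x\<^sup>2 + y\<^sup>2)" using p assms by simp
    ultimately have "1 \<le> ?C * (1 - y\<^sup>2 / (x\<^sup>2 + y\<^sup>2))"
      by (metis le_divide_eq_1_pos times_divide_times_eq)
    then show ?thesis using True by simp
  next
    case False
    have "y\<^sup>2 / (x\<^sup>2 + y\<^sup>2) \<le> 1" using assms by (intro divide_le_eq_1_pos[THEN iffD2] add_nonneg_pos) auto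
    then show ?thesis using False by (auto intro!: mult_nonneg_nonneg)
  qed
  then have "(\<integral>x. indicator ?A x \<partial>M) \<le> (\<integral>x. ?C * (1 - y\<^sup>2 / (x\<^sup>2 + y\<^sup>2)) \<partial>M)"
    using A integrable_sq_over_sum[OF assms(1)]
    by (intro integral_mono) (auto simp: integrable_indicator_iff emeasure_eq_measure)
  also have "\<dots> = ?C * (1 - (\<integral>x. y\<^sup>2 / (x\<^sup>2 + y\<^sup>2) \<partial>M))"
    using integrable_sq_over_sum[OF assms(1)]
    by (simp add: Bochner_Integration.integral_diff prob_space[simplified])
  finally show ?thesis unfolding Re_ii_cauchy_transform[OF assms(1)] using A by simp
qed

lemma exists_tail_le:
  assumes "e > 0" shows "\<exists>K>0. measure M {x. K < \<bar>x\<bar>} \<le> e"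
proof -
  have "(\<lambda>n. measure M {x. real n < \<bar>x\<bar>}) \<longlonglongrightarrow> measure M (\<Inter>n. {x. real n < \<bar>x\<bar>})"
    by (rule finite_Lim_measure_decseq) (auto simp: decseq_def)
  also have "(\<Inter>n. {x. real n < \<bar>x\<bar>}) = {}"
  proof (intro equals0I)
    fix x :: real assume x: "x \<in> (\<Inter>n. {x. real n < \<bar>x\<bar>})"
    obtain n where "\<bar>x\<bar> \<le> real n" using real_arch_simple by blast
    then show False using x by (auto dest: spec[of _ n])
  qed
  finally have "\<forall>\<^sub>F n in sequentially. measure M {x. real n < \<bar>x\<bar>} < e"
    using assms by (intro order_tendstoD) auto
  from eventually_happens'[OF _ eventually_conj[OF this eventually_gt_at_top[of 0]]]
  obtain n where n: "measure M {x. real n < \<bar>x\<bar>} < e" "n > 0" by auto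
  then show ?thesis by (intro exI[of _ "real n"]) auto
qed

text \<open>The second assumption keeps \<open>w\<close> in a cone around the imaginary axis, where
  |w| / Im w stays bounded. A general path is allowed because the lemma is later applied along the
  image of the imaginary axis under another F-transform.\<close>

lemma mult_cauchy_transform_tendsto_1:
  assumes "\<forall>\<^sub>F t in F. Im (w t) > 0" "\<forall>\<^sub>F t in F. norm (w t) \<le> C * Im (w t)"
    and "filterlim (\<lambda>t. Im (w t)) at_top F"
  shows "((\<lambda>t. w t * cauchy_transform M (w t)) \<longlongrightarrow> 1) F"
proof (rule tendstoI)
  fix e :: real assume "e > 0"
  \<comment> \<open>Makes the tail term at most e / 3; the absolute value keeps the denominator
    positive whatever the sign of \<open>C\<close>.\<close>
  define e' where "e' = e / (3 * (1 + \<bar>C\<bar>))"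
  have e': "e' > 0" using \<open>e > 0\<close> by (auto simp: e'_def)
  have ee: "e' * (1 + \<bar>C\<bar>) = e / 3" by (simp add: e'_def field_simps)
  obtain K where K: "K > 0" "measure M {x. K < \<bar>x\<bar>} \<le> e'" using exists_tail_le[OF e'] by auto
  have "\<forall>\<^sub>F t in F. Im (w t) \<ge> 3 * K / e" using assms(3) by (auto simp: filterlim_at_top)
  with assms(1,2) show "\<forall>\<^sub>F t in F. dist (w t * cauchy_transform M (w t)) 1 < e"
  proof eventually_elim
    case (elim t)
    have "norm (w t) / Im (w t) \<le> C" using elim by (simp add: field_simps)
    then have "e' * (1 + norm (w t) / Im (w t)) \<le> e' * (1 + \<bar>C\<bar>)"
      using e' by (intro mult_left_mono) auto
    moreover have "K / Im (w t) \<le> e / 3" using elim \<open>e > 0\<close> by (simp add: field_simps)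
    moreover have "norm (w t * cauchy_transform M (w t) - 1) \<le> K / Im (w t) + e' * (1 + norm (w t) / Im (w t))"
      using norm_mult_cauchy_transform_le[of "w t" K e'] elim K e' by auto
    ultimately have "norm (w t * cauchy_transform M (w t) - 1) \<le> e / 3 + e / 3"
      unfolding ee by (meson add_mono order_trans)
    then show ?case using \<open>e > 0\<close> by (simp add: dist_norm)
  qed
qed

lemma ii_cauchy_transform_tendsto_1:
  "((\<lambda>y. \<i> * complex_of_real y * cauchy_transform M (\<i> * complex_of_real y)) \<longlongrightarrow> 1) at_top"
proof (rule mult_cauchy_transform_tendsto_1[where C = 1])
  show "\<forall>\<^sub>F y in at_top. Im (\<i> * complex_of_real y) > 0"
    by (simp add: eventually_gt_at_top)
  show "\<forall>\<^sub>F y in at_top. norm (\<i> * complex_of_real y) \<le> 1 * Im (\<i> * complex_of_real y)"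
    using eventually_ge_at_top[of 0] by eventually_elim (simp add: norm_mult)
qed (simp add: filterlim_ident)

end

section \<open>Dilations, point masses and limits of Cauchy transforms\<close>

lemma real_distribution_dilation:
  assumes "real_distribution \<mu>" shows "real_distribution (dilation c \<mu>)"
proof -
  interpret real_distribution \<mu> by fact
  show ?thesis unfolding dilation_def by (rule real_distribution_distr) simp
qed

lemma cauchy_transform_dilation:
  assumes "real_distribution \<mu>" "c > 0"
  shows "cauchy_transform (dilation c \<mu>) z = cauchy_transform \<mu> (z / complex_of_real c) / complex_of_real c"
proof -
  interpret real_distribution \<mu> by fact
  have "cauchy_transform (dilation c \<mu>) z = (\<integral>x. 1 / (z - complex_of_real (c * x)) \<partial>\<mu>)"
    unfolding cauchy_transform_def dilation_def by (rule integral_distr) auto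
  also have "\<dots> = (\<integral>x. 1 / (z / complex_of_real c - complex_of_real x) / complex_of_real c \<partial>\<mu>)"
  proof (intro Bochner_Integration.integral_cong refl)
    fix x
    have "z - complex_of_real (c * x) = complex_of_real c * (z / complex_of_real c - complex_of_real x)"
      using assms(2) by (simp add: right_diff_distrib)
    then show "1 / (z - complex_of_real (c * x)) = 1 / (z / complex_of_real c - complex_of_real x) / complex_of_real c"
      by (simp add: mult.commute)
  qed
  finally show ?thesis by (simp only: cauchy_transform_def integral_divide_zero)
qed

lemma F_transform_dilation:
  assumes "real_distribution \<mu>" "c > 0"
  shows "F_transform (dilation c \<mu>) z = complex_of_real c * F_transform \<mu> (z / complex_of_real c)"
  unfolding F_transform_def cauchy_transform_dilation[OF assms] by simp

lemma real_distribution_return: "real_distribution (return borel (a::real))"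
  by (intro real_distribution.intro prob_space_return real_distribution_axioms.intro) auto

lemma cauchy_transform_return: "cauchy_transform (return borel a) z = 1 / (z - complex_of_real a)"
  unfolding cauchy_transform_def by (subst integral_return) auto

lemma F_transform_return_0: "F_transform (return borel 0) z = z"
  by (simp add: F_transform_def cauchy_transform_return)

lemma weak_conv_m_imp_cauchy_transform:
  assumes "\<And>n. real_distribution (M n)" "real_distribution \<mu>" "weak_conv_m M \<mu>" "Im z > 0"
  shows "(\<lambda>n. cauchy_transform (M n) z) \<longlonglongrightarrow> cauchy_transform \<mu> z"
  unfolding cauchy_transform_def
proof (rule weak_conv_imp_integral_bdd_continuous_conv[OF assms(1-3)])
  show "isCont (\<lambda>x. 1 / (z - complex_of_real x)) x" for x
    using diff_of_real_nonzero[OF assms(4), of x] by (intro continuous_intros) auto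
qed (rule norm_cauchy_kernel_le[OF assms(4)])

text \<open>The Lipschitz bound for Cauchy transforms does not depend on the law, so law and
  argument may move at the same time.\<close>

lemma cauchy_transform_tendsto_compose:
  assumes "\<And>n. real_distribution (M n)" "Im w > 0"
    and "(\<lambda>n. cauchy_transform (M n) w) \<longlonglongrightarrow> g" "v \<longlonglongrightarrow> w"
  shows "(\<lambda>n. cauchy_transform (M n) (v n)) \<longlonglongrightarrow> g"
proof -
  have Imv: "(\<lambda>n. Im (v n)) \<longlonglongrightarrow> Im w" by (intro tendsto_intros assms)
  then have pos: "\<forall>\<^sub>F n in sequentially. Im (v n) > 0" using assms(2) by (rule order_tendstoD)
  have bound: "\<forall>\<^sub>F n in sequentially. norm (cauchy_transform (M n) (v n) - cauchy_transform (M n) w)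
      \<le> norm (v n - w) / (Im (v n) * Im w)"
    using pos by eventually_elim (intro real_distribution.cauchy_transform_lipschitz assms)
  have "(\<lambda>n. norm (v n - w) / (Im (v n) * Im w)) \<longlonglongrightarrow> norm (w - w) / (Im w * Im w)"
    using assms(2) by (intro tendsto_intros assms Imv) auto
  then have "(\<lambda>n. norm (v n - w) / (Im (v n) * Im w)) \<longlonglongrightarrow> 0" by simp
  from Lim_null_comparison[OF bound this]
  have "(\<lambda>n. cauchy_transform (M n) (v n) - cauchy_transform (M n) w) \<longlonglongrightarrow> 0" .
  from tendsto_add[OF this assms(3)] show ?thesis by simp
qed

subsection \<open>Stieltjes inversion\<close>

lemma nn_integral_Poisson_kernel:
  fixes b t y :: real
  assumes "y > 0"
  shows "(\<integral>\<^sup>+x. ennreal (y / ((x - t)\<^sup>2 + y\<^sup>2)) * indicator {b..} x \<partial>lborel)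
    = ennreal (pi / 2 - arctan ((b - t) / y))"
proof (rule nn_integral_FTC_atLeast)
  fix x
  have p: "(x - t)\<^sup>2 + y\<^sup>2 > 0" using assms by (simp add: add_nonneg_pos)
  show "0 \<le> y / ((x - t)\<^sup>2 + y\<^sup>2)" using assms p by simp
  have "((\<lambda>x. arctan ((x - t) / y)) has_real_derivative 1 / y / (1 + ((x - t) / y)\<^sup>2)) (at x)"
    using assms by (auto intro!: derivative_eq_intros simp: field_simps)
  moreover have "1 / y / (1 + ((x - t) / y)\<^sup>2) = y / ((x - t)\<^sup>2 + y\<^sup>2)"
  proof -
    have "1 + ((x - t) / y)\<^sup>2 = ((x - t)\<^sup>2 + y\<^sup>2) / y\<^sup>2"
      using assms by (simp add: field_simps)
    then show ?thesis using assms p by (simp add: power2_eq_square)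
  qed
  ultimately show "((\<lambda>x. arctan ((x - t) / y)) has_real_derivative y / ((x - t)\<^sup>2 + y\<^sup>2)) (at x)"
    by simp
next
  have "filterlim (\<lambda>x. (x - t) / y) at_top at_top"
    using assms by (intro filterlim_at_top_mult_tendsto_pos[of "\<lambda>_. 1 / y" "1 / y", simplified]
      filterlim_tendsto_add_at_top[OF tendsto_const[of "-t"], simplified] filterlim_ident)
  then show "((\<lambda>x. arctan ((x - t) / y)) \<longlongrightarrow> pi / 2) at_top"
    by (rule filterlim_compose[OF tendsto_arctan_at_top])
qed simp

text \<open>Tonelli applied to the Poisson kernel. The right side depends on \<open>M\<close> only
  through its Cauchy transform at height \<open>y\<close>; the left side is a smoothed version of
  \<pi> times the mass beyond \<open>b\<close>.\<close>

lemma (in real_distribution) expectation_arctan_eq: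
  assumes "y > 0"
  shows "ennreal (\<integral>t. pi / 2 - arctan ((b - t) / y) \<partial>M) =
    (\<integral>\<^sup>+x. ennreal (- Im (cauchy_transform M (Complex x y))) * indicator {b..} x \<partial>lborel)"
proof -
  interpret pair_sigma_finite lborel M by unfold_locales
  have nn: "pi / 2 - arctan u \<ge> 0" for u using arctan_ubound[of u] by simp
  have int: "integrable M (\<lambda>t. pi / 2 - arctan ((b - t) / y))"
  proof (rule integrable_const_bound[where B = pi])
    show "AE t in M. norm (pi / 2 - arctan ((b - t) / y)) \<le> pi"
      using arctan_lbound arctan_ubound by (intro AE_I2) (simp add: abs_le_iff less_imp_le, smt (verit) field_sum_of_halves)
  qed measurable
  have kernel: "y / ((x - t)\<^sup>2 + y\<^sup>2) = y * (1 / (norm (Complex x y - complex_of_real t))\<^sup>2)" for x t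
    by (simp add: cmod_power2)
  have "ennreal (\<integral>t. pi / 2 - arctan ((b - t) / y) \<partial>M) = (\<integral>\<^sup>+t. ennreal (pi / 2 - arctan ((b - t) / y)) \<partial>M)"
    by (rule nn_integral_eq_integral[symmetric, OF int]) (intro AE_I2 nn)
  also have "\<dots> = (\<integral>\<^sup>+t. \<integral>\<^sup>+x. ennreal (y / ((x - t)\<^sup>2 + y\<^sup>2)) * indicator {b..} x \<partial>lborel \<partial>M)"
    unfolding nn_integral_Poisson_kernel[OF assms] ..
  also have "\<dots> = (\<integral>\<^sup>+x. \<integral>\<^sup>+t. ennreal (y / ((x - t)\<^sup>2 + y\<^sup>2)) * indicator {b..} x \<partial>M \<partial>lborel)"
    by (rule Fubini') measurable
  also have "\<dots> = (\<integral>\<^sup>+x. ennreal (- Im (cauchy_transform M (Complex x y))) * indicator {b..} x \<partial>lborel)"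
  proof (rule nn_integral_cong)
    fix x
    have "(\<integral>\<^sup>+t. ennreal (y / ((x - t)\<^sup>2 + y\<^sup>2)) \<partial>M) = ennreal (\<integral>t. y / ((x - t)\<^sup>2 + y\<^sup>2) \<partial>M)"
      unfolding kernel using integrable_cauchy_kernel_sq[of "Complex x y"] assms
      by (intro nn_integral_eq_integral integrable_mult_right) auto
    also have "(\<integral>t. y / ((x - t)\<^sup>2 + y\<^sup>2) \<partial>M) = - Im (cauchy_transform M (Complex x y))"
      unfolding kernel integral_mult_right_zero using Im_cauchy_transform[of "Complex x y"] assms by simp
    finally show "(\<integral>\<^sup>+t. ennreal (y / ((x - t)\<^sup>2 + y\<^sup>2)) * indicator {b..} x \<partial>M) =
      ennreal (- Im (cauchy_transform M (Complex x y))) * indicator {b..} x"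
      by (subst nn_integral_multc) auto
  qed
  finally show ?thesis .
qed

text \<open>Coupling the height \<open>1 / n\<^sup>2\<close> with the shift \<open>1 / n\<close> of the end point keeps the
  limit free of the half-weights that Stieltjes inversion assigns to atoms at end points.\<close>

lemma arctan_indicator_limit:
  fixes b t :: real
  shows "(\<lambda>n. pi / 2 - arctan ((b + 1 / real (Suc n) - t) / (1 / (real (Suc n))\<^sup>2)))
    \<longlonglongrightarrow> pi * indicator {b<..} t"
proof -
  have eq: "(b + 1 / real (Suc n) - t) / (1 / (real (Suc n))\<^sup>2)
      = real (Suc n) * (real (Suc n) * (b - t) + 1)" for n
    by (simp add: power2_eq_square field_simps del: of_nat_Suc)
  have lim: "filterlim (\<lambda>n. real (Suc n)) at_top sequentially"
    by (intro filterlim_compose[OF filterlim_real_sequentially] filterlim_Suc)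
  show ?thesis
  proof (cases "t \<le> b")
    case True
    have "filterlim (\<lambda>n. real (Suc n) * (real (Suc n) * (b - t) + 1)) at_top sequentially"
    proof (rule filterlim_at_top_mono[OF lim], intro always_eventually allI)
      fix n
      have "real (Suc n) * 1 \<le> real (Suc n) * (real (Suc n) * (b - t) + 1)"
        using True by (intro mult_left_mono) auto
      then show "real (Suc n) \<le> real (Suc n) * (real (Suc n) * (b - t) + 1)" by simp
    qed
    from filterlim_compose[OF tendsto_arctan_at_top this]
    have "(\<lambda>n. pi / 2 - arctan (real (Suc n) * (real (Suc n) * (b - t) + 1))) \<longlonglongrightarrow> pi / 2 - pi / 2"
      by (intro tendsto_diff tendsto_const)
    then show ?thesis using True unfolding eq by simp
  next
    case False
    have "filterlim (\<lambda>n. - (real (Suc n) * (real (Suc n) * (b - t) + 1))) at_top sequentially"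
    proof (rule filterlim_at_top_mono[OF lim])
      have "\<forall>\<^sub>F n in sequentially. real (Suc n) \<ge> 2 / (t - b)"
        using lim unfolding filterlim_at_top by blast
      then show "\<forall>\<^sub>F n in sequentially. real (Suc n) \<le> - (real (Suc n) * (real (Suc n) * (b - t) + 1))"
      proof eventually_elim
        case (elim n)
        then have "2 \<le> real (Suc n) * (t - b)" using False by (simp add: field_simps del: of_nat_Suc)
        then have "real (Suc n) * 1 \<le> real (Suc n) * (real (Suc n) * (t - b) - 1)"
          by (intro mult_left_mono) auto
        then show ?case by (simp add: algebra_simps del: of_nat_Suc)
      qed
    qed
    then have "filterlim (\<lambda>n. real (Suc n) * (real (Suc n) * (b - t) + 1)) at_bot sequentially"
      by (simp only: filterlim_uminus_at_top minus_minus)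
    from filterlim_compose[OF tendsto_arctan_at_bot this]
    have "(\<lambda>n. pi / 2 - arctan (real (Suc n) * (real (Suc n) * (b - t) + 1))) \<longlonglongrightarrow> pi / 2 - (- (pi / 2))"
      by (intro tendsto_diff tendsto_const)
    then show ?thesis using False unfolding eq by simp
  qed
qed

lemma (in real_distribution) arctan_expectation_tendsto:
  "(\<lambda>n. \<integral>t. pi / 2 - arctan ((b + 1 / real (Suc n) - t) / (1 / (real (Suc n))\<^sup>2)) \<partial>M)
    \<longlonglongrightarrow> pi * (1 - cdf M b)"
proof -
  have "(\<lambda>n. \<integral>t. pi / 2 - arctan ((b + 1 / real (Suc n) - t) / (1 / (real (Suc n))\<^sup>2)) \<partial>M)
    \<longlonglongrightarrow> (\<integral>t. pi * indicator {b<..} t \<partial>M)"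
  proof (rule integral_dominated_convergence[where w = "\<lambda>_. pi"])
    show "AE t in M. norm (pi / 2 - arctan ((b + 1 / real (Suc n) - t) / (1 / (real (Suc n))\<^sup>2))) \<le> pi" for n
    proof (rule AE_I2)
      fix t
      show "norm (pi / 2 - arctan ((b + 1 / real (Suc n) - t) / (1 / (real (Suc n))\<^sup>2))) \<le> pi"
        using arctan_lbound[of "(b + 1 / real (Suc n) - t) / (1 / (real (Suc n))\<^sup>2)"]
          arctan_ubound[of "(b + 1 / real (Suc n) - t) / (1 / (real (Suc n))\<^sup>2)"]
        unfolding real_norm_def by linarith
    qed
    show "AE t in M. (\<lambda>n. pi / 2 - arctan ((b + 1 / real (Suc n) - t) / (1 / (real (Suc n))\<^sup>2)))
      \<longlonglongrightarrow> pi * indicator {b<..} t"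
      using arctan_indicator_limit by simp
  qed auto
  also have "(\<integral>t. pi * indicator {b<..} t \<partial>M) = pi * measure M {b<..}" by simp
  also have "measure M {b<..} = 1 - cdf M b"
    using prob_compl[of "{..b}"] by (simp add: cdf_def Compl_eq_Diff_UNIV[symmetric])
  finally show ?thesis .
qed

text \<open>The smoothed masses are determined by the Cauchy transform, and their limit is the
  distribution function at every \<open>b\<close>, atoms included, so no exceptional points have to
  be filled in by right-continuity.\<close>

lemma cauchy_transform_unique:
  assumes \<mu>: "real_distribution \<mu>" and \<nu>: "real_distribution \<nu>"
    and eq: "\<And>z. Im z > 0 \<Longrightarrow> cauchy_transform \<mu> z = cauchy_transform \<nu> z"
  shows "\<mu> = \<nu>"
proof (rule cdf_unique[OF \<mu> \<nu>], rule ext)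
  fix b
  have nn: "0 \<le> (\<integral>t. pi / 2 - arctan ((b' - t) / y) \<partial>M)" for b' y and M :: "real measure"
    using arctan_ubound by (intro Bochner_Integration.integral_nonneg) (simp add: less_imp_le)
  have *: "(\<integral>t. pi / 2 - arctan ((b' - t) / y) \<partial>\<mu>) = (\<integral>t. pi / 2 - arctan ((b' - t) / y) \<partial>\<nu>)"
    if "y > 0" for b' y
  proof -
    have "ennreal (\<integral>t. pi / 2 - arctan ((b' - t) / y) \<partial>\<mu>) = ennreal (\<integral>t. pi / 2 - arctan ((b' - t) / y) \<partial>\<nu>)"
      unfolding real_distribution.expectation_arctan_eq[OF \<mu> that]
        real_distribution.expectation_arctan_eq[OF \<nu> that]
      using that by (simp add: eq)
    then show ?thesis using nn by (simp only: ennreal_inj)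
  qed
  have "(\<integral>t. pi / 2 - arctan ((b + 1 / real (Suc n) - t) / (1 / (real (Suc n))\<^sup>2)) \<partial>\<mu>) =
    (\<integral>t. pi / 2 - arctan ((b + 1 / real (Suc n) - t) / (1 / (real (Suc n))\<^sup>2)) \<partial>\<nu>)" for n
    by (rule *) simp
  then have "pi * (1 - cdf \<mu> b) = pi * (1 - cdf \<nu> b)"
    using real_distribution.arctan_expectation_tendsto[OF \<mu>, of b]
      real_distribution.arctan_expectation_tendsto[OF \<nu>, of b]
    using LIMSEQ_unique by (simp only:) blast
  then show "cdf \<mu> b = cdf \<nu> b" by simp
qed

subsection \<open>Rational F-transforms\<close>

lemma degree_prod_linear: "degree (\<Prod>u\<in>R. [:- u, 1::'a::field:]) = card R"
  by (subst degree_prod_eq_sum_degree) (auto simp: pCons_eq_0_iff)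

lemma lead_coeff_prod_linear: "coeff (\<Prod>u\<in>R. [:- u, 1::'a::field:]) (card R) = 1"
  using lead_coeff_prod[of "\<lambda>u. [:- u, 1::'a:]" R] by (simp add: degree_prod_linear)

lemma poly_prod_linear: "poly (\<Prod>u\<in>R. [:- u, 1::'a::field:]) z = (\<Prod>u\<in>R. z - u)"
  by (simp add: poly_prod)

text \<open>\<open>A\<close> is the numerator of the partial fraction sum of a_s / (z - s) over the
  common denominator, the product of all z - u. Its coefficient in degree \<open>card S - 1\<close>
  is the total weight; this is how total mass 1 is followed from one set of poles to
  another.\<close>

lemma lagrange_basis_sum:
  fixes S :: "'a::field set" and a :: "'a \<Rightarrow> 'a"
  assumes "finite S"
  defines "L \<equiv> \<lambda>s. \<Prod>u\<in>S - {s}. [:- u, 1:]"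
  defines "A \<equiv> \<Sum>s\<in>S. smult (a s) (L s)"
  shows "s \<in> S \<Longrightarrow> poly A s = a s * poly (L s) s"
    and "coeff A (card S - 1) = sum a S"
    and "S \<noteq> {} \<Longrightarrow> degree A < card S"
    and "z \<notin> S \<Longrightarrow> poly A z = (\<Prod>u\<in>S. z - u) * (\<Sum>s\<in>S. a s / (z - s))"
proof -
  have card: "card (S - {s}) = card S - 1" if "s \<in> S" for s using that assms(1) by simp
  have "poly (L t) s = 0" if "s \<in> S" "t \<in> S" "t \<noteq> s" for s t
    using that assms(1) by (auto simp: L_def poly_prod intro!: prod_zero)
  then show "poly A s = a s * poly (L s) s" if "s \<in> S"
    using that assms(1) by (simp add: A_def poly_sum sum.remove[of S s])
  have "coeff (L s) (card S - 1) = 1" if "s \<in> S" for s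
    using lead_coeff_prod_linear[of "S - {s}"] card[OF that] by (simp add: L_def)
  then show "coeff A (card S - 1) = sum a S" by (simp add: A_def coeff_sum)
  show "degree A < card S" if "S \<noteq> {}"
  proof -
    have "degree A \<le> card S - 1"
      unfolding A_def
      by (intro degree_sum_le assms order_trans[OF degree_smult_le])
        (simp add: L_def degree_prod_linear card)
    then show ?thesis using that assms(1) by (metis Suc_pred' card_gt_0_iff less_Suc_eq_le)
  qed
  show "poly A z = (\<Prod>u\<in>S. z - u) * (\<Sum>s\<in>S. a s / (z - s))" if "z \<notin> S"
  proof -
    have "(\<Prod>u\<in>S. z - u) * (a s / (z - s)) = a s * (\<Prod>u\<in>S - {s}. z - u)" if "s \<in> S" for s
      using \<open>z \<notin> S\<close> that assms(1) by (subst prod.remove[of S s]) auto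
    then show ?thesis
      by (simp add: A_def L_def poly_sum poly_prod sum_distrib_left)
  qed
qed

text \<open>Both sides have degree below \<open>card S\<close> and agree on \<open>S\<close>.
  Divided by the product of all z - s, this is the partial fraction decomposition with simple
  poles.\<close>

lemma lagrange_interpolation:
  fixes S :: "'a::field_char_0 set"
  assumes "finite S" "degree A < card S"
  shows "A = (\<Sum>s\<in>S. smult (poly A s / (\<Prod>u\<in>S - {s}. s - u)) (\<Prod>u\<in>S - {s}. [:- u, 1:]))"
    (is "A = ?Q")
proof (rule poly_eqI_degree)
  have "S \<noteq> {}" using assms by auto
  then show "degree ?Q < card S" by (intro lagrange_basis_sum assms)
  fix s assume "s \<in> S"
  have "(\<Prod>u\<in>S - {s}. s - u) \<noteq> 0" using assms(1) by auto
  then show "poly A s = poly ?Q s"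
    using lagrange_basis_sum(1)[OF assms(1) \<open>s \<in> S\<close>] by (simp add: poly_prod)
qed (use assms in auto)

text \<open>Dividing by \<open>Im z\<close> covers both half-planes at once: to show that the roots
  of a polynomial are real, the lower half-plane has to be excluded as well.\<close>

lemma Im_sum_cauchy_kernel_neg:
  assumes "finite T" "\<And>t. t \<in> T \<Longrightarrow> q t > 0" "T \<noteq> {}" "Im z \<noteq> 0"
  shows "Im (\<Sum>t\<in>T. complex_of_real (q t) / (z - complex_of_real t)) / Im z < 0"
proof -
  have nz: "z - complex_of_real t \<noteq> 0" for t using assms(4) by (auto simp: complex_eq_iff)
  have "Im (complex_of_real (q t) / (z - complex_of_real t)) / Im z
      = - (q t / (norm (z - complex_of_real t))\<^sup>2)" for t
    using assms(4) by (simp add: Im_divide cmod_power2)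
  then have "Im (\<Sum>t\<in>T. complex_of_real (q t) / (z - complex_of_real t)) / Im z
      = - (\<Sum>t\<in>T. q t / (norm (z - complex_of_real t))\<^sup>2)"
    by (simp add: sum_divide_distrib sum_negf)
  moreover have "(\<Sum>t\<in>T. q t / (norm (z - complex_of_real t))\<^sup>2) > 0"
    using assms nz by (intro sum_pos divide_pos_pos) auto
  ultimately show ?thesis by simp
qed

text \<open>Numerator and denominator of \<open>1 / (F - x) = G / (1 - x G)\<close> are polynomials.  A zero of the
  denominator solves \<open>G = 1 / x\<close>, hence is real; it is simple because \<open>G' < 0\<close> on the real line
  outside the poles, and the same inequality makes the residue positive.\<close>

lemma finitely_supported_shift:
  fixes T :: "real set" and q :: "real \<Rightarrow> real" and x :: real
  assumes fin: "finite T" and q: "\<And>t. t \<in> T \<Longrightarrow> q t > 0" and sum_q: "sum q T = 1"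
  obtains S r where "finite S" "\<And>s. s \<in> S \<Longrightarrow> r s > 0" "sum r S = 1"
    "\<And>z. Im z > 0 \<Longrightarrow>
       1 / (1 / (\<Sum>t\<in>T. complex_of_real (q t) / (z - complex_of_real t)) - complex_of_real x)
       = (\<Sum>s\<in>S. complex_of_real (r s) / (z - complex_of_real s))"
\<comment> \<open>For \<open>x = 0\<close> the expression is G itself; otherwise the poles are the
  solutions of G = 1 / x.\<close>
proof (cases "x = 0")
  case True
  then show ?thesis using that[of T q] assms by simp
next
  case False
  define c where "c = complex_of_real"
  have inj: "inj_on c X" for X by (auto simp: inj_on_def c_def)
  have c_eq [simp]: "c a = c b \<longleftrightarrow> a = b" for a b by (simp add: c_def)
  have T0: "T \<noteq> {}" using sum_q by auto
  define T' where "T' = c ` T"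
  have T': "finite T'" "T' \<noteq> {}" "card T' = card T"
    using fin T0 by (auto simp: T'_def card_image[OF inj])
  define a where "a = (\<lambda>w. c (q (Re w)))"
  have a_c: "a (c t) = c (q t)" for t by (simp add: a_def c_def)
  define A where "A = (\<Sum>s\<in>T'. smult (a s) (\<Prod>u\<in>T' - {s}. [:- u, 1:]))"
  define B where "B = (\<Prod>u\<in>T'. [:- u, 1:])"
  \<comment> \<open>With g = A / B, one has 1 / (1 / g - x) = A / (B - x A), so \<open>P\<close> is
    the new denominator. It is monic of the degree of \<open>B\<close>, since \<open>A\<close> has
    smaller degree.\<close>
  define P where "P = B - smult (c x) A"
  define g where "g = (\<lambda>z. \<Sum>t\<in>T. c (q t) / (z - c t))"
  have g_alt: "g z = (\<Sum>s\<in>T'. a s / (z - s))" for z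
    unfolding g_def T'_def by (subst sum.reindex[OF inj]) (simp add: a_c)
  have A_eq: "poly A z = poly B z * g z" if "z \<notin> T'" for z
    unfolding A_def B_def g_alt poly_prod_linear by (rule lagrange_basis_sum(4)[OF T'(1) that])
  have degA: "degree A < card T'" unfolding A_def by (intro lagrange_basis_sum T')
  have coeffA: "coeff A (card T' - 1) = 1"
  proof -
    have "coeff A (card T' - 1) = sum a T'" unfolding A_def by (rule lagrange_basis_sum(2)[OF T'(1)])
    also have "\<dots> = c (sum q T)"
      unfolding T'_def by (subst sum.reindex[OF inj]) (simp add: a_c, simp add: c_def)
    finally show ?thesis using sum_q by (simp add: c_def)
  qed
  have degP: "degree P = card T'"
    unfolding P_def diff_conv_add_uminus smult_minus_left[symmetric]
    using degA degree_smult_le[of "- c x" A]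
    by (subst degree_add_eq_left) (auto simp: B_def degree_prod_linear)
  have leadP: "lead_coeff P = 1"
    unfolding degP unfolding P_def using degA lead_coeff_prod_linear[of T']
    by (simp add: B_def coeff_eq_0)
  have B_nz: "poly B z \<noteq> 0" if "z \<notin> T'" for z
    using that T'(1) by (auto simp: B_def poly_prod)
  have root_notin: "s \<notin> T'" if "poly P s = 0" for s
  proof
    assume s: "s \<in> T'"
    then have "poly B s = 0" using T'(1) by (auto simp: B_def poly_prod intro!: prod_zero)
    with that have "poly A s = 0" using False by (simp add: P_def c_def)
    moreover have "poly A s = a s * (\<Prod>u\<in>T' - {s}. s - u)"
      unfolding A_def using lagrange_basis_sum(1)[OF T'(1) s, of a] by (simp add: poly_prod)
    moreover obtain t where "t \<in> T" "s = c t" using s by (auto simp: T'_def)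
    then have "a s \<noteq> 0" using q[of t] by (simp add: a_c, simp add: c_def)
    ultimately show False using T'(1) by auto
  qed
  have P_eq: "poly P z = poly B z * (1 - c x * g z)" if "z \<notin> T'" for z
    unfolding P_def using A_eq[OF that] by (simp add: algebra_simps)
  have root_g: "g s = 1 / c x" if "poly P s = 0" for s
    using P_eq[OF root_notin[OF that]] that B_nz[OF root_notin[OF that]] False
    by (simp add: c_def field_simps)
  have root_real: "Im s = 0" if "poly P s = 0" for s
  proof (rule ccontr)
    assume "Im s \<noteq> 0"
    then have "Im (g s) / Im s < 0"
      unfolding g_def c_def by (intro Im_sum_cauchy_kernel_neg fin q T0)
    then show False using root_g[OF that] by (simp add: c_def)
  qed
  \<comment> \<open>\<open>W\<close> is minus the derivative of \<open>g\<close> on the real line.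
    Differentiating P = B (1 - x g) at a root leaves only the term B x W.\<close>
  define W where "W = (\<lambda>s. \<Sum>t\<in>T. q t / (s - t)\<^sup>2)"
  have root_c: "s = c (Re s)" if "poly P s = 0" for s
    using root_real[OF that] by (simp add: complex_eq_iff c_def)
  have W_pos: "W (Re s) > 0" if "poly P s = 0" for s
    unfolding W_def using fin T0 root_notin[OF that] root_c[OF that]
    by (intro sum_pos divide_pos_pos q) (auto simp: T'_def)
  have deriv: "poly (pderiv P) s = poly B s * (c x * c (W (Re s)))" if r: "poly P s = 0" for s
  proof -
    define s' where "s' = Re s"
    have s: "s = c s'" using root_c[OF r] by (simp add: s'_def)
    have nT: "s - c t \<noteq> 0" if "t \<in> T" for t using that root_notin[OF r] by (auto simp: T'_def)
    have "((\<lambda>z. \<Sum>t\<in>T. c (q t) / (z - c t)) has_field_derivative (\<Sum>t\<in>T. - (c (q t)) / (s - c t)\<^sup>2)) (at s)"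
      using nT by (intro DERIV_sum) (auto intro!: derivative_eq_intros simp: power2_eq_square)
    also have "(\<Sum>t\<in>T. - (c (q t)) / (s - c t)\<^sup>2) = - c (W s')"
      by (simp add: W_def s c_def sum_negf)
    finally have g': "(g has_field_derivative - c (W s')) (at s)" by (simp add: g_def)
    have "((\<lambda>z. poly B z * (1 - c x * g z)) has_field_derivative
        poly (pderiv B) s * (1 - c x * g s) + poly B s * (c x * c (W s'))) (at s)"
      by (auto intro!: derivative_eq_intros poly_DERIV g')
    then have "(poly P has_field_derivative
        poly (pderiv B) s * (1 - c x * g s) + poly B s * (c x * c (W s'))) (at s)"
    proof (rule has_field_derivative_transform_within_open[where S = "- T'"])
      show "open (- T')" using T'(1) by (simp add: finite_imp_closed open_Compl)
    qed (use root_notin[OF r] P_eq in auto)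
    from DERIV_unique[OF poly_DERIV this] root_g[OF r] False
    show ?thesis by (simp add: c_def s'_def)
  qed
  have "rsquarefree P"
    unfolding rsquarefree_roots
  proof (intro allI notI)
    fix s assume "poly P s = 0 \<and> poly (pderiv P) s = 0"
    then show False using deriv[of s] W_pos[of s] B_nz[OF root_notin[of s]] False by (auto simp: c_def)
  qed
  define R where "R = {z. poly P z = 0}"
  \<comment> \<open>Since all roots are simple and \<open>P\<close> is monic, \<open>P\<close> is
    the product over its root set, so there are exactly as many new poles as old ones.\<close>
  have P_prod: "P = (\<Prod>z\<in>R. [:- z, 1:])"
    using complex_poly_decompose_rsquarefree[OF \<open>rsquarefree P\<close>] leadP by (simp add: R_def)
  have R: "finite R" "card R = card T'"
  proof -
    have "P \<noteq> 0" using leadP by auto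
    then show "finite R" unfolding R_def by (rule poly_roots_finite)
    show "card R = card T'" using degree_prod_linear[of R] P_prod degP by simp
  qed
  define \<rho> where "\<rho> = (\<lambda>s. poly A s / (\<Prod>u\<in>R - {s}. s - u))"
  have A_R: "A = (\<Sum>s\<in>R. smult (\<rho> s) (\<Prod>u\<in>R - {s}. [:- u, 1:]))"
    unfolding \<rho>_def using R degA by (intro lagrange_interpolation) auto
  \<comment> \<open>The residue A / P' at a root: there A = B / x, because g = 1 / x, and P' = B x
    W.\<close>
  define r where "r = (\<lambda>s. 1 / (x\<^sup>2 * W s))"
  have \<rho>_r: "\<rho> s = c (r (Re s))" if "s \<in> R" for s
  proof -
    have r0: "poly P s = 0" using that by (simp add: R_def)
    have "P = [:- s, 1:] * (\<Prod>z\<in>R - {s}. [:- z, 1:])"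
      by (rule trans[OF P_prod prod.remove[OF R(1) that]])
    then have "poly (pderiv P) s = poly (\<Prod>z\<in>R - {s}. [:- z, 1:]) s"
      by (simp add: pderiv_mult pderiv_pCons del: mult_pCons_left)
    then have "\<rho> s = poly A s / poly (pderiv P) s" by (simp add: \<rho>_def poly_prod)
    also have "poly A s = poly B s * (1 / c x)" using A_eq[OF root_notin[OF r0]] root_g[OF r0] by simp
    finally show ?thesis
      unfolding deriv[OF r0] using B_nz[OF root_notin[OF r0]] False
      by (simp add: r_def c_def power2_eq_square)
  qed
  define S where "S = Re ` R"
  have R_S: "R = c ` S" using root_c by (force simp: S_def R_def image_iff)
  have sum_R: "(\<Sum>s\<in>R. f s) = (\<Sum>s\<in>S. f (c s))" for f :: "complex \<Rightarrow> complex"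
    unfolding R_S by (subst sum.reindex[OF inj]) simp
  have \<rho>_S: "\<rho> (c s) = c (r s)" if "s \<in> S" for s
    using \<rho>_r[of "c s"] that by (simp add: R_S c_def)
  show ?thesis
  proof (rule that[of S r])
    show "finite S" using R by (simp add: S_def)
    show "r s > 0" if "s \<in> S" for s
      using W_pos that False by (auto simp: r_def S_def R_def)
    \<comment> \<open>The sum of the residues is the coefficient of \<open>A\<close> in degree
      \<open>card R - 1\<close>, which is the total weight of \<open>q\<close>.\<close>
    have "c (sum r S) = sum \<rho> R" unfolding sum_R using \<rho>_S by (simp add: c_def)
    also have "\<dots> = 1"
      using lagrange_basis_sum(2)[OF R(1), of \<rho>] coeffA unfolding A_R[symmetric] R(2) by simp
    finally show "sum r S = 1" by (simp only: c_def of_real_eq_1_iff)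
  next
    fix z :: complex assume z: "Im z > 0"
    have zT: "z \<notin> T'" and zR: "z \<notin> R" using z root_real by (auto simp: T'_def c_def R_def)
    have "Im (g z) / Im z < 0"
      unfolding g_def c_def using z by (intro Im_sum_cauchy_kernel_neg fin q T0) auto
    then have gz: "g z \<noteq> 0" by auto
    have "poly A z = poly P z * (\<Sum>s\<in>R. \<rho> s / (z - s))"
      using lagrange_basis_sum(4)[OF R(1) zR, of \<rho>] unfolding A_R[symmetric]
      by (simp add: P_prod poly_prod)
    moreover have "poly P z \<noteq> 0" using zR by (simp add: R_def)
    ultimately have "(\<Sum>s\<in>R. \<rho> s / (z - s)) = poly A z / poly P z" by simp
    also have "\<dots> = g z / (1 - c x * g z)"
      unfolding A_eq[OF zT] P_eq[OF zT] using B_nz[OF zT] by simp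
    also have "\<dots> = 1 / (1 / g z - c x)" using gz by (simp add: field_simps)
    finally show "1 / (1 / (\<Sum>t\<in>T. complex_of_real (q t) / (z - complex_of_real t)) - complex_of_real x)
       = (\<Sum>s\<in>S. complex_of_real (r s) / (z - complex_of_real s))"
      unfolding sum_R using \<rho>_S by (simp add: c_def g_def)
  qed
qed

subsection \<open>Existence of the monotone convolution\<close>

lemma finitely_supported_distribution:
  fixes S :: "real set"
  assumes "finite S" "\<And>s. s \<in> S \<Longrightarrow> r s \<ge> 0" "sum r S = 1"
  obtains \<rho> where "real_distribution \<rho>"
    "\<And>z. cauchy_transform \<rho> z = (\<Sum>s\<in>S. complex_of_real (r s) / (z - complex_of_real s))"
proof -
  define P where "P = point_measure S (\<lambda>s. ennreal (r s))"
  have P: "prob_space P"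
  proof (rule prob_spaceI)
    have "emeasure P (space P) = (\<Sum>s\<in>S. ennreal (r s))"
      unfolding P_def by (simp add: space_point_measure emeasure_point_measure_finite assms(1))
    also have "\<dots> = ennreal (sum r S)" by (rule sum_ennreal) (use assms in auto)
    finally show "emeasure P (space P) = 1" using assms by simp
  qed
  have meas [measurable]: "(\<lambda>x. x) \<in> measurable P borel" by (simp add: P_def)
  show ?thesis
  proof (rule that[of "distr P borel (\<lambda>x. x)"])
    show "real_distribution (distr P borel (\<lambda>x. x))"
      using P meas by (rule prob_space.real_distribution_distr)
    show "cauchy_transform (distr P borel (\<lambda>x. x)) z
      = (\<Sum>s\<in>S. complex_of_real (r s) / (z - complex_of_real s))" for z
    proof -
      have "cauchy_transform (distr P borel (\<lambda>x. x)) z = (\<integral>x. 1 / (z - complex_of_real x) \<partial>P)"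
        unfolding cauchy_transform_def by (rule integral_distr[OF meas]) measurable
      also have "\<dots> = (\<Sum>s\<in>S. r s *\<^sub>R (1 / (z - complex_of_real s)))"
        unfolding P_def by (rule lebesgue_integral_point_measure_finite) (use assms in auto)
      finally show ?thesis by (simp add: scaleR_conv_of_real)
    qed
  qed
qed

text \<open>The right side is the Cauchy transform of a finitely supported law evaluated at F of
  another one. For each \<open>x\<close> the kernel 1 / (F - x) is the Cauchy transform of a
  probability law by \<open>finitely_supported_shift\<close>; averaging these laws with the weights
  \<open>p x\<close> gives the composition.\<close>

lemma finitely_supported_compose:
  fixes X T :: "real set"
  assumes X: "finite X" "\<And>x. x \<in> X \<Longrightarrow> p x > 0" "sum p X = 1"
    and T: "finite T" "\<And>t. t \<in> T \<Longrightarrow> q t > 0" "sum q T = 1"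
  obtains \<rho> where "real_distribution \<rho>"
    "\<And>z. Im z > 0 \<Longrightarrow> cauchy_transform \<rho> z = (\<Sum>x\<in>X. complex_of_real (p x) /
      (1 / (\<Sum>t\<in>T. complex_of_real (q t) / (z - complex_of_real t)) - complex_of_real x))"
proof -
  define g where "g = (\<lambda>z. \<Sum>t\<in>T. complex_of_real (q t) / (z - complex_of_real t))"
  define Q where "Q = (\<lambda>x S r. finite S \<and> (\<forall>s\<in>S. r s > 0) \<and> sum r S = 1 \<and>
      (\<forall>z. Im z > 0 \<longrightarrow> 1 / (1 / g z - complex_of_real x)
        = (\<Sum>s\<in>S. complex_of_real (r s) / (z - complex_of_real s))))"
  have "\<exists>S r. Q x S r" for x
  proof (rule finitely_supported_shift[of T q x])
    fix S r
    assume "finite S" "\<And>s. s \<in> S \<Longrightarrow> r s > 0" "sum r S = 1"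
      "\<And>z. Im z > 0 \<Longrightarrow>
         1 / (1 / (\<Sum>t\<in>T. complex_of_real (q t) / (z - complex_of_real t)) - complex_of_real x)
         = (\<Sum>s\<in>S. complex_of_real (r s) / (z - complex_of_real s))"
    then have "Q x S r" unfolding Q_def g_def by simp
    then show ?thesis by blast
  qed (use T in auto)
  then obtain S r where "\<And>x. Q x (S x) (r x)" by metis
  then have S: "\<And>x. finite (S x)" "\<And>x s. s \<in> S x \<Longrightarrow> r x s > 0" "\<And>x. sum (r x) (S x) = 1"
    and kernel: "\<And>x z. Im z > 0 \<Longrightarrow> 1 / (1 / g z - complex_of_real x)
        = (\<Sum>s\<in>S x. complex_of_real (r x s) / (z - complex_of_real s))"
    unfolding Q_def by blast+
  \<comment> \<open>Extension by zero to the union \<open>U\<close> of all supports, so that the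
    sums over poles and over \<open>X\<close> can be interchanged.\<close>
  define r' where "r' = (\<lambda>x s. if s \<in> S x then r x s else 0)"
  define U where "U = (\<Union>x\<in>X. S x)"
  define R where "R = (\<lambda>s. \<Sum>x\<in>X. p x * r' x s)"
  have U: "finite U" using X S by (auto simp: U_def)
  \<comment> \<open>Stated for a general \<open>c\<close> because it serves twice: with the identity
    for the total mass and with \<open>complex_of_real\<close> for the Cauchy transform.\<close>
  have sum_U: "(\<Sum>s\<in>U. c (r' x s) * f s) = (\<Sum>s\<in>S x. c (r x s) * f s)"
    if "x \<in> X" "c 0 = 0" for x and f :: "real \<Rightarrow> 'b::semiring_0" and c
    by (rule sum.mono_neutral_cong_right) (use U that in \<open>auto simp: U_def r'_def\<close>)
  have "sum R U = (\<Sum>x\<in>X. p x * (\<Sum>s\<in>U. r' x s * 1))"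
    unfolding R_def by (subst sum.swap) (simp add: sum_distrib_left)
  also have "\<dots> = 1" using sum_U[of _ "\<lambda>x. x" "\<lambda>_. 1::real"] S(3) X(3) by simp
  finally have "sum R U = 1" .
  moreover have "R s \<ge> 0" for s
    unfolding R_def by (intro sum_nonneg mult_nonneg_nonneg) (use X S in \<open>auto simp: r'_def less_imp_le\<close>)
  ultimately obtain \<rho> where \<rho>: "real_distribution \<rho>"
    "\<And>z. cauchy_transform \<rho> z = (\<Sum>s\<in>U. complex_of_real (R s) / (z - complex_of_real s))"
    using finitely_supported_distribution[OF U, of R] by blast
  show ?thesis
  proof (rule that[OF \<rho>(1)])
    fix z :: complex assume z: "Im z > 0"
    have "cauchy_transform \<rho> z = (\<Sum>s\<in>U. \<Sum>x\<in>X. complex_of_real (p x) *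
        (complex_of_real (r' x s) * (1 / (z - complex_of_real s))))"
      unfolding \<rho>(2) R_def by (simp add: sum_divide_distrib)
    also have "\<dots> = (\<Sum>x\<in>X. complex_of_real (p x) *
        (\<Sum>s\<in>U. complex_of_real (r' x s) * (1 / (z - complex_of_real s))))"
      by (subst sum.swap) (simp add: sum_distrib_left)
    also have "\<dots> = (\<Sum>x\<in>X. complex_of_real (p x) * (1 / (1 / g z - complex_of_real x)))"
      unfolding kernel[OF z] using sum_U[of _ complex_of_real "\<lambda>s. 1 / (z - complex_of_real s)"] by simp
    finally show "cauchy_transform \<rho> z = (\<Sum>x\<in>X. complex_of_real (p x) /
      (1 / (\<Sum>t\<in>T. complex_of_real (q t) / (z - complex_of_real t)) - complex_of_real x))"
      by (simp add: g_def)
  qed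
qed

lemma (in prob_space) simple_function_distribution:
  fixes f :: "'a \<Rightarrow> real"
  assumes f: "simple_function M f"
  obtains X p where "finite X" "\<And>x. x \<in> X \<Longrightarrow> p x > 0" "sum p X = 1"
    "\<And>h :: real \<Rightarrow> complex. (\<integral>w. h (f w) \<partial>M) = (\<Sum>x\<in>X. complex_of_real (p x) * h x)"
proof -
  define V where "V = f ` space M"
  define p where "p = (\<lambda>v. prob (f -` {v} \<inter> space M))"
  have V: "finite V" using f by (simp add: V_def simple_function_def)
  have meas: "f -` {v} \<inter> space M \<in> events" for v by (rule simple_functionD(2)[OF f])
  have int: "(\<integral>w. h (f w) \<partial>M) = (\<Sum>v\<in>V. complex_of_real (p v) * h v)" for h :: "real \<Rightarrow> complex"
  proof -
    have "(\<integral>w. h (f w) \<partial>M) = (\<integral>w. (\<Sum>v\<in>V. indicator (f -` {v} \<inter> space M) w *\<^sub>R h v) \<partial>M)"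
    proof (rule Bochner_Integration.integral_cong)
      fix w assume w: "w \<in> space M"
      have "(\<Sum>v\<in>V. indicator (f -` {v} \<inter> space M) w *\<^sub>R h v) = (\<Sum>v\<in>V. if v = f w then h v else 0)"
        using w by (intro sum.cong) (auto simp: indicator_def)
      also have "\<dots> = h (f w)" using w V by (simp add: V_def)
      finally show "h (f w) = (\<Sum>v\<in>V. indicator (f -` {v} \<inter> space M) w *\<^sub>R h v)" by simp
    qed simp
    also have "\<dots> = (\<Sum>v\<in>V. \<integral>w. indicator (f -` {v} \<inter> space M) w *\<^sub>R h v \<partial>M)"
      using meas
      by (intro Bochner_Integration.integral_sum integrable_scaleR_left)
        (auto simp: integrable_indicator_iff emeasure_eq_measure)
    also have "\<dots> = (\<Sum>v\<in>V. complex_of_real (p v) * h v)"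
      using meas
      by (intro sum.cong refl, subst integral_scaleR_left)
        (auto simp: p_def scaleR_conv_of_real integrable_indicator_iff emeasure_eq_measure)
    finally show ?thesis .
  qed
  \<comment> \<open>Values taken with probability 0 are discarded because the weights must be
    strictly positive when the shifted kernels are decomposed.\<close>
  define X where "X = {v \<in> V. p v > 0}"
  have int_X: "(\<integral>w. h (f w) \<partial>M) = (\<Sum>v\<in>X. complex_of_real (p v) * h v)" for h :: "real \<Rightarrow> complex"
    unfolding int
    by (rule sum.mono_neutral_right) (use V in \<open>auto simp: X_def p_def zero_less_measure_iff\<close>)
  show ?thesis
  proof (rule that[of X p, OF _ _ _ int_X])
    have "complex_of_real (sum p X) = 1" using int_X[of "\<lambda>_. 1"] by (simp add: prob_space)
    then show "sum p X = 1" by (simp only: of_real_eq_1_iff)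
  qed (use V in \<open>auto simp: X_def\<close>)
qed

text \<open>Simple functions converge pointwise to the identity on the probability space of \<mu>
  itself; their laws are the approximants, and dominated convergence with bound 1 / Im z gives the
  limit.\<close>

lemma finitely_supported_approximation:
  assumes "real_distribution \<mu>"
  obtains M X p where "\<And>n. real_distribution (M n)"
    "\<And>n. finite (X n)" "\<And>n x. x \<in> X n \<Longrightarrow> p n x > 0" "\<And>n. sum (p n) (X n) = 1"
    "\<And>n z. cauchy_transform (M n) z = (\<Sum>x\<in>X n. complex_of_real (p n x) / (z - complex_of_real x))"
    "\<And>z. Im z > 0 \<Longrightarrow> (\<lambda>n. cauchy_transform (M n) z) \<longlonglongrightarrow> cauchy_transform \<mu> z"
proof -
  interpret real_distribution \<mu> by fact
  obtain f where f: "\<And>n. simple_function \<mu> (f n)" "\<And>x. (\<lambda>n. f n x) \<longlonglongrightarrow> x"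
    using borel_measurable_implies_sequence_metric[of "\<lambda>x. x" \<mu> 0] by auto
  have meas [measurable]: "f n \<in> borel_measurable \<mu>" for n
    by (rule borel_measurable_simple_function[OF f(1)])
  have "\<exists>X p. finite X \<and> (\<forall>x\<in>X. p x > 0) \<and> sum p X = 1 \<and>
    (\<forall>h :: real \<Rightarrow> complex. (\<integral>w. h (f n w) \<partial>\<mu>) = (\<Sum>x\<in>X. complex_of_real (p x) * h x))" for n
    by (rule simple_function_distribution[OF f(1)[of n]]) blast
  then obtain X p where Xp: "\<And>n. finite (X n)" "\<And>n x. x \<in> X n \<Longrightarrow> p n x > 0" "\<And>n. sum (p n) (X n) = 1"
    and int: "\<And>n (h :: real \<Rightarrow> complex). (\<integral>w. h (f n w) \<partial>\<mu>) = (\<Sum>x\<in>X n. complex_of_real (p n x) * h x)"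
    by metis
  have ct: "cauchy_transform (distr \<mu> borel (f n)) z = (\<integral>w. 1 / (z - complex_of_real (f n w)) \<partial>\<mu>)" for n z
    unfolding cauchy_transform_def by (rule integral_distr) measurable
  show ?thesis
  proof (rule that[of "\<lambda>n. distr \<mu> borel (f n)" X p])
    show "cauchy_transform (distr \<mu> borel (f n)) z
      = (\<Sum>x\<in>X n. complex_of_real (p n x) / (z - complex_of_real x))" for n z
      unfolding ct int[of "\<lambda>x. 1 / (z - complex_of_real x)"] by simp
    show "(\<lambda>n. cauchy_transform (distr \<mu> borel (f n)) z) \<longlonglongrightarrow> cauchy_transform \<mu> z" if z: "Im z > 0" for z
      unfolding ct unfolding cauchy_transform_def
    proof (rule integral_dominated_convergence[where w = "\<lambda>_. 1 / Im z"])
      show "AE x in \<mu>. (\<lambda>n. 1 / (z - complex_of_real (f n x))) \<longlonglongrightarrow> 1 / (z - complex_of_real x)"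
        by (intro AE_I2 tendsto_divide tendsto_diff tendsto_const tendsto_of_real f(2)
            diff_of_real_nonzero(1)[OF z])
      show "AE x in \<mu>. norm (1 / (z - complex_of_real (f n x))) \<le> 1 / Im z" for n
        using norm_cauchy_kernel_le[OF z] by auto
    qed auto
  qed (use Xp in auto)
qed

section \<open>Tightness and the continuity theorem for Cauchy transforms\<close>

lemma tightI_tails:
  assumes M: "\<And>n. real_distribution (M n)"
    and tail: "\<And>e. e > 0 \<Longrightarrow> \<exists>K>0. \<forall>\<^sub>F n in sequentially. measure (M n) {x. K < \<bar>x\<bar>} \<le> e"
  shows "tight M"
  unfolding tight_def
proof (intro conjI allI impI)
  fix e :: real assume e: "e > 0"
  obtain K N where K: "K > 0" "\<And>n. n \<ge> N \<Longrightarrow> measure (M n) {x. K < \<bar>x\<bar>} \<le> e / 2"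
    using tail[of "e / 2"] e by (auto simp: eventually_sequentially)
  have "\<exists>K>0. measure (M n) {x. K < \<bar>x\<bar>} \<le> e / 2" for n
    using e by (intro real_distribution.exists_tail_le[OF M]) simp
  then obtain L where L: "\<And>n. L n > 0" "\<And>n. measure (M n) {x. L n < \<bar>x\<bar>} \<le> e / 2" by metis
  \<comment> \<open>The finitely many laws before \<open>N\<close> are tight one by one; the sum of
    their cut-offs is an upper bound for each of them.\<close>
  define K' where "K' = K + (\<Sum>n<N. L n)"
  have L_sum: "(\<Sum>n<N. L n) \<ge> 0" using L(1) by (intro sum_nonneg less_imp_le) auto
  then have K': "K' > 0" using K(1) by (simp add: K'_def)
  have tail': "measure (M n) {x. K' < \<bar>x\<bar>} \<le> e / 2" for n
  proof -
    interpret real_distribution "M n" by (rule M)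
    have mono: "measure (M n) {x. K' < \<bar>x\<bar>} \<le> measure (M n) {x. a < \<bar>x\<bar>}" if "a \<le> K'" for a
      using that by (intro finite_measure_mono) auto
    show ?thesis
    proof (cases "n \<ge> N")
      case True
      show ?thesis using L_sum mono[of K] K(2)[OF True] by (simp add: K'_def)
    next
      case False
      have "L n \<le> (\<Sum>n<N. L n)" using False L(1) by (intro member_le_sum less_imp_le) auto
      then show ?thesis using mono[of "L n"] L(2)[of n] K(1) by (simp add: K'_def)
    qed
  qed
  show "\<exists>a b. a < b \<and> (\<forall>n. 1 - e < measure (M n) {a<..b})"
  proof (intro exI conjI allI)
    \<comment> \<open>The interval is open on the left, so its end point is moved by 1 to keep -K'
      inside.\<close>
    show "- K' - 1 < K'" using K' by simp
    fix n
    interpret real_distribution "M n" by (rule M)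
    have "measure (M n) (UNIV - {- K' - 1<..K'}) \<le> measure (M n) {x. K' < \<bar>x\<bar>}"
      by (intro finite_measure_mono) auto
    then show "1 - e < measure (M n) {- K' - 1<..K'}"
      using prob_compl[of "{- K' - 1<..K'}"] tail'[of n] e by simp
  qed
qed (rule M)

text \<open>The behaviour of \<open>g\<close> at infinity prevents loss of mass: some height
  \<open>y\<close> has Re (iy g(iy)) > 1 - e/2, hence so have almost all members of the sequence,
  and the tail inequality with \<open>d = y\<close> costs a factor 2.\<close>

lemma cauchy_transform_limit_tails:
  assumes M: "\<And>n. real_distribution (M n)"
    and lim: "\<And>z. Im z > 0 \<Longrightarrow> (\<lambda>n. cauchy_transform (M n) z) \<longlonglongrightarrow> g z"
    and g: "((\<lambda>y. \<i> * complex_of_real y * g (\<i> * complex_of_real y)) \<longlongrightarrow> 1) at_top"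
    and e: "e > 0"
  shows "\<exists>K>0. \<forall>\<^sub>F n in sequentially. measure (M n) {x. K < \<bar>x\<bar>} \<le> e"
proof -
  have "((\<lambda>y. Re (\<i> * complex_of_real y * g (\<i> * complex_of_real y))) \<longlongrightarrow> Re 1) at_top"
    by (rule tendsto_Re[OF g])
  then have "\<forall>\<^sub>F y in at_top. Re (\<i> * complex_of_real y * g (\<i> * complex_of_real y)) > 1 - e / 2"
    using e by (intro order_tendstoD) auto
  from eventually_happens'[OF _ eventually_conj[OF this eventually_gt_at_top[of 0]]]
  obtain y where y: "Re (\<i> * complex_of_real y * g (\<i> * complex_of_real y)) > 1 - e / 2" "y > 0"
    by auto
  let ?z = "\<i> * complex_of_real y"
  have "(\<lambda>n. Re (?z * cauchy_transform (M n) ?z)) \<longlonglongrightarrow> Re (?z * g ?z)"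
    using y by (intro tendsto_Re tendsto_mult_left lim) auto
  then have "\<forall>\<^sub>F n in sequentially. Re (?z * cauchy_transform (M n) ?z) > 1 - e / 2"
    using y(1) by (rule order_tendstoD)
  then have "\<forall>\<^sub>F n in sequentially. measure (M n) {x. y < \<bar>x\<bar>} \<le> e"
  proof eventually_elim
    case (elim n)
    then show ?case using real_distribution.measure_tail_le[OF M[of n] y(2) y(2)] y(2) by simp
  qed
  then show ?thesis using y(2) by blast
qed

text \<open>\<open>g\<close> is not assumed to be a Cauchy transform. Tightness provides a weak
  limit along a subsequence, and its Cauchy transform must be \<open>g\<close>.\<close>

lemma cauchy_transform_continuity:
  assumes M: "\<And>n. real_distribution (M n)"
    and lim: "\<And>z. Im z > 0 \<Longrightarrow> (\<lambda>n. cauchy_transform (M n) z) \<longlonglongrightarrow> g z"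
    and g: "((\<lambda>y. \<i> * complex_of_real y * g (\<i> * complex_of_real y)) \<longlongrightarrow> 1) at_top"
  obtains \<rho> where "real_distribution \<rho>" "\<And>z. Im z > 0 \<Longrightarrow> cauchy_transform \<rho> z = g z"
proof -
  have "tight M" by (rule tightI_tails[OF M cauchy_transform_limit_tails[OF M lim g]])
  then obtain r \<rho> where r: "strict_mono r" "real_distribution \<rho>" "weak_conv_m (M \<circ> id \<circ> r) \<rho>"
    using tight_imp_convergent_subsubsequence[of M id] by (auto simp: strict_mono_id)
  show ?thesis
  proof (rule that[OF r(2)])
    fix z :: complex assume z: "Im z > 0"
    have "(\<lambda>n. cauchy_transform ((M \<circ> id \<circ> r) n) z) \<longlonglongrightarrow> cauchy_transform \<rho> z"
      using M by (intro weak_conv_m_imp_cauchy_transform r z) auto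
    moreover have "(\<lambda>n. cauchy_transform ((M \<circ> id \<circ> r) n) z) \<longlonglongrightarrow> g z"
      using LIMSEQ_subseq_LIMSEQ[OF lim[OF z] r(1)] by (simp add: o_def)
    ultimately show "cauchy_transform \<rho> z = g z" by (rule LIMSEQ_unique)
  qed
qed

lemma F_transform_tendsto:
  assumes "real_distribution \<nu>" "Im z > 0" "((\<lambda>n. cauchy_transform (M n) z) \<longlongrightarrow> cauchy_transform \<nu> z) F"
  shows "((\<lambda>n. F_transform (M n) z) \<longlongrightarrow> F_transform \<nu> z) F"
  unfolding F_transform_def
  using real_distribution.cauchy_transform_nonzero[OF assms(1,2)] by (intro tendsto_intros assms)

lemma F_transform_compose_exists:
  assumes \<mu>: "real_distribution \<mu>" and \<nu>: "real_distribution \<nu>"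
  obtains \<rho> where "real_distribution \<rho>"
    "\<And>z. Im z > 0 \<Longrightarrow> cauchy_transform \<rho> z = cauchy_transform \<mu> (F_transform \<nu> z)"
proof -
  obtain M X p where M: "\<And>n. real_distribution (M n)"
    and Xp: "\<And>n. finite (X n)" "\<And>n x. x \<in> X n \<Longrightarrow> p n x > 0" "\<And>n. sum (p n) (X n) = 1"
    and GM: "\<And>n z. cauchy_transform (M n) z = (\<Sum>x\<in>X n. complex_of_real (p n x) / (z - complex_of_real x))"
    and limM: "\<And>z. Im z > 0 \<Longrightarrow> (\<lambda>n. cauchy_transform (M n) z) \<longlonglongrightarrow> cauchy_transform \<mu> z"
    using finitely_supported_approximation[OF \<mu>] by blast
  obtain N T q where N: "\<And>n. real_distribution (N n)"
    and Tq: "\<And>n. finite (T n)" "\<And>n x. x \<in> T n \<Longrightarrow> q n x > 0" "\<And>n. sum (q n) (T n) = 1"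
    and GN: "\<And>n z. cauchy_transform (N n) z = (\<Sum>x\<in>T n. complex_of_real (q n x) / (z - complex_of_real x))"
    and limN: "\<And>z. Im z > 0 \<Longrightarrow> (\<lambda>n. cauchy_transform (N n) z) \<longlonglongrightarrow> cauchy_transform \<nu> z"
    using finitely_supported_approximation[OF \<nu>] by blast
  have "\<exists>\<rho>. real_distribution \<rho> \<and>
    (\<forall>z. Im z > 0 \<longrightarrow> cauchy_transform \<rho> z = cauchy_transform (M n) (F_transform (N n) z))" for n
    unfolding F_transform_def GM GN
    by (rule finitely_supported_compose[of "X n" "p n" "T n" "q n"]) (use Xp Tq in blast)+
  then obtain R where R: "\<And>n. real_distribution (R n)"
    "\<And>n z. Im z > 0 \<Longrightarrow> cauchy_transform (R n) z = cauchy_transform (M n) (F_transform (N n) z)"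
    by metis
  define g where "g = (\<lambda>z. cauchy_transform \<mu> (F_transform \<nu> z))"
  interpret \<nu>: real_distribution \<nu> by fact
  interpret \<mu>: real_distribution \<mu> by fact
  have lim: "(\<lambda>n. cauchy_transform (R n) z) \<longlonglongrightarrow> g z" if z: "Im z > 0" for z
    unfolding R(2)[OF z] g_def
    by (rule cauchy_transform_tendsto_compose[OF M \<nu>.Im_F_transform_pos[OF z]
          limM[OF \<nu>.Im_F_transform_pos[OF z]] F_transform_tendsto[OF \<nu> z limN[OF z]]])
  \<comment> \<open>No mass is lost in the composition: iy g(iy) factors as \<open>k y\<close> times
    w G_\<mu>(w) with w = F_\<nu>(iy), and both factors tend to 1.\<close>
  have g_1: "((\<lambda>y. \<i> * complex_of_real y * g (\<i> * complex_of_real y)) \<longlongrightarrow> 1) at_top"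
  proof -
    define w where "w = (\<lambda>y. F_transform \<nu> (\<i> * complex_of_real y))"
    define k where "k = (\<lambda>y. \<i> * complex_of_real y * cauchy_transform \<nu> (\<i> * complex_of_real y))"
    have k: "(k \<longlongrightarrow> 1) at_top" unfolding k_def by (rule \<nu>.ii_cauchy_transform_tendsto_1)
    have pos: "\<forall>\<^sub>F y in at_top. (y::real) > 0" by (rule eventually_gt_at_top)
    have Im_w: "Im (w y) \<ge> y" if "y > 0" for y
      using \<nu>.Im_F_transform_ge[of "\<i> * complex_of_real y"] that by (simp add: w_def)
    have kw: "k y * w y = \<i> * complex_of_real y" if "y > 0" for y
      using \<nu>.cauchy_transform_nonzero[of "\<i> * complex_of_real y"] that
      by (simp add: k_def w_def F_transform_def)
    \<comment> \<open>The cone constant 2 comes from \<open>k y * w y\<close> = iy: once |k y| \<ge>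
      1/2, it follows that |w y| \<le> 2 y \<le> 2 Im (w y).\<close>
    have "((\<lambda>y. w y * cauchy_transform \<mu> (w y)) \<longlongrightarrow> 1) at_top"
    proof (rule \<mu>.mult_cauchy_transform_tendsto_1[where C = 2])
      show "\<forall>\<^sub>F y in at_top. Im (w y) > 0" using pos by eventually_elim (use Im_w in force)
      show "filterlim (\<lambda>y. Im (w y)) at_top at_top"
      proof (rule filterlim_at_top_mono[OF filterlim_ident])
        show "\<forall>\<^sub>F y in at_top. y \<le> Im (w y)" using pos by eventually_elim (rule Im_w)
      qed
      have "\<forall>\<^sub>F y in at_top. dist (k y) 1 < 1 / 2" using k by (rule tendstoD) simp
      with pos show "\<forall>\<^sub>F y in at_top. norm (w y) \<le> 2 * Im (w y)"
      proof eventually_elim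
        case (elim y)
        have "norm (k y) \<ge> 1 / 2"
          using elim norm_triangle_ineq2[of 1 "1 - k y"] by (simp add: dist_norm norm_minus_commute)
        then have "1 / 2 * norm (w y) \<le> norm (k y) * norm (w y)" by (intro mult_right_mono) auto
        also have "\<dots> = y" using kw[of y] elim by (metis norm_mult norm_ii norm_of_real abs_of_pos mult_1)
        finally show ?case using Im_w[of y] elim by simp
      qed
    qed
    from tendsto_mult[OF k this]
    have "((\<lambda>y. k y * (w y * cauchy_transform \<mu> (w y))) \<longlongrightarrow> 1) at_top" by simp
    then show ?thesis
    proof (rule Lim_transform_eventually)
      show "\<forall>\<^sub>F y in at_top. k y * (w y * cauchy_transform \<mu> (w y)) = \<i> * complex_of_real y * g (\<i> * complex_of_real y)"
        using pos
      proof eventually_elim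
        case (elim y)
        have "k y * (w y * cauchy_transform \<mu> (w y)) = \<i> * complex_of_real y * cauchy_transform \<mu> (w y)"
          unfolding kw[OF elim, symmetric] by (rule mult.assoc[symmetric])
        then show ?case unfolding g_def w_def .
      qed
    qed
  qed
  show ?thesis
  proof (rule cauchy_transform_continuity[of R g])
    fix \<rho> assume "real_distribution \<rho>" "\<And>z. Im z > 0 \<Longrightarrow> cauchy_transform \<rho> z = g z"
    then show ?thesis by (intro that[of \<rho>]) (auto simp: g_def)
  qed (rule R(1) lim g_1; assumption?)+
qed

lemma F_transform_eq_iff: "F_transform \<mu> z = F_transform \<nu> z' \<longleftrightarrow> cauchy_transform \<mu> z = cauchy_transform \<nu> z'"
  by (auto simp: F_transform_def)

text \<open>Existence and Stieltjes uniqueness make the \<open>THE\<close> in the definition proper.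
  The third fact is the tool for proving that a given law is a convolution.\<close>

lemma monotone_conv_spec:
  assumes "real_distribution \<mu>" "real_distribution \<nu>"
  shows "real_distribution (\<mu> \<rhd> \<nu>)"
    and "Im z > 0 \<Longrightarrow> F_transform (\<mu> \<rhd> \<nu>) z = F_transform \<mu> (F_transform \<nu> z)"
    and "real_distribution \<rho> \<Longrightarrow> (\<And>z. Im z > 0 \<Longrightarrow> F_transform \<rho> z = F_transform \<mu> (F_transform \<nu> z)) \<Longrightarrow>
      \<rho> = \<mu> \<rhd> \<nu>"
proof -
  let ?P = "\<lambda>\<rho>. real_distribution \<rho> \<and>
     (\<forall>z\<in>upper_half_plane. F_transform \<rho> z = F_transform \<mu> (F_transform \<nu> z))"
  have unique: "\<rho> = \<sigma>" if "?P \<rho>" "?P \<sigma>" for \<rho> \<sigma>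
    using that by (intro cauchy_transform_unique) (auto simp: F_transform_eq_iff[symmetric])
  from F_transform_compose_exists[OF assms] obtain \<rho>0 where "real_distribution \<rho>0"
    "\<And>z. Im z > 0 \<Longrightarrow> cauchy_transform \<rho>0 z = cauchy_transform \<mu> (F_transform \<nu> z)"
    by blast
  then have ex: "\<exists>\<rho>. ?P \<rho>" by (intro exI[of _ \<rho>0]) (simp add: F_transform_eq_iff)
  have P: "?P (\<mu> \<rhd> \<nu>)"
    unfolding monotone_conv_def by (rule theI') (use ex unique in blast)
  then show "real_distribution (\<mu> \<rhd> \<nu>)"
    and "Im z > 0 \<Longrightarrow> F_transform (\<mu> \<rhd> \<nu>) z = F_transform \<mu> (F_transform \<nu> z)" by auto
  show "\<rho> = \<mu> \<rhd> \<nu>" if "real_distribution \<rho>"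
    "\<And>z. Im z > 0 \<Longrightarrow> F_transform \<rho> z = F_transform \<mu> (F_transform \<nu> z)"
    using unique[OF _ P, of \<rho>] that by simp
qed

subsection \<open>Tightness of right factors\<close>

context real_distribution
begin

text \<open>Approximate inversion of F high up: \<open>v\<close> is F(w), and w = v (w G(w)) with w
  G(w) close to 1. So if \<open>v\<close> is close to iy, then so is every preimage \<open>w\<close>
  of height at least \<open>y\<close>.\<close>

lemma F_transform_preimage_estimate:
  assumes e: "0 < e" "e \<le> 1 / 12" and y: "y > 0" and K: "0 \<le> K" "K \<le> e * y"
    and tail: "measure M {x. K < \<bar>x\<bar>} \<le> e" and w: "Im w \<ge> y"
    and v: "v * cauchy_transform M w = 1" "norm (v / (\<i> * complex_of_real y) - 1) \<le> e"
  shows "norm (w / (\<i> * complex_of_real y) - 1) \<le> 6 * e"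
proof -
  define u where "u = \<i> * complex_of_real y"
  define d where "d = norm (w * cauchy_transform M w - 1)"
  define r where "r = norm (w / u)"
  have u: "norm u = y" "u \<noteq> 0" using y by (auto simp: u_def norm_mult)
  have r: "r = norm w / y" using u by (simp add: r_def norm_divide)
  have "K / Im w \<le> K / y" using w y K by (intro divide_left_mono) auto
  also have "\<dots> \<le> e" using K y by (simp add: field_simps)
  finally have "K / Im w \<le> e" .
  moreover have "norm w / Im w \<le> r" unfolding r using w y by (intro divide_left_mono) auto
  then have "e * (1 + norm w / Im w) \<le> e * (1 + r)" using e by (intro mult_left_mono) auto
  ultimately have "K / Im w + e * (1 + norm w / Im w) \<le> e + e * (1 + r)" by (rule add_mono)
  moreover have "d \<le> K / Im w + e * (1 + norm w / Im w)"
    unfolding d_def using w y K e tail by (intro norm_mult_cauchy_transform_le) auto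
  ultimately have "d \<le> e + e * (1 + r)" by linarith
  then have d: "d \<le> 2 * e + e * r" by (simp add: algebra_simps)
  have vu: "norm (v / u) \<le> 1 + e"
    using v(2) norm_triangle_ineq[of "v / u - 1" 1] by (simp add: u_def)
  have "w / u = w * (v * cauchy_transform M w) / u" using v(1) by simp
  then have wu: "w / u - 1 = (w * cauchy_transform M w - 1) * (v / u) + (v / u - 1)"
    by (simp add: algebra_simps)
  have "norm (w / u - 1) \<le> norm ((w * cauchy_transform M w - 1) * (v / u)) + norm (v / u - 1)"
    unfolding wu by (rule norm_triangle_ineq)
  also have "\<dots> \<le> d * (1 + e) + e"
    unfolding norm_mult d_def using vu v(2) by (intro add_mono mult_left_mono) (auto simp: u_def)
  finally have *: "norm (w / u - 1) \<le> d * (1 + e) + e" .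
  have d0: "d \<ge> 0" by (simp add: d_def)
  have "d * (1 + e) \<le> d * (13 / 12)" using e d0 by (intro mult_left_mono) auto
  with * have **: "norm (w / u - 1) \<le> 13 / 12 * d + e" by simp
  have r0: "r \<ge> 0" by (simp add: r_def)
  have "r \<le> norm (w / u - 1) + 1"
    using norm_triangle_ineq[of "w / u - 1" 1] by (simp add: r_def)
  moreover have "e * r \<le> 1 / 12 * r" using e r0 by (intro mult_right_mono) auto
  \<comment> \<open>A bootstrap: the bound for \<open>d\<close> contains |w| / y = \<open>r\<close>
    itself. As e \<le> 1/12, the term e r can be absorbed, giving r \<le> 2; inserted again this
    yields d \<le> 4 e and the final 6 e.\<close>
  ultimately have "r \<le> 2" using ** d e by argo
  then have "e * r \<le> e * 2" using e by (intro mult_left_mono) auto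
  then have "norm (w / u - 1) \<le> 6 * e" using ** d e by argo
  then show ?thesis by (simp add: u_def)
qed

text \<open>The difference quotient of G, normalised by \<open>w * u\<close>, is close to 1. With w
  / (w - x) = 1 + p and u / (u - x) = 1 + q, the deviation (1 + p)(1 + q) - 1 is at most 3 e where
  |x| \<le> \<open>K\<close> and at most 3 elsewhere, in total 6 e \<le> 1/2.\<close>

lemma cauchy_kernel_prod_estimate:
  assumes e: "0 < e" "e \<le> 1 / 12" and y: "y > 0" and K: "0 \<le> K" "K \<le> e * y"
    and tail: "measure M {x. K < \<bar>x\<bar>} \<le> e"
    and w: "Im w \<ge> y" "norm w \<le> 2 * y" and u: "Im u = y" "norm u = y"
  shows "norm (w * u * (\<integral>x. 1 / ((w - complex_of_real x) * (u - complex_of_real x)) \<partial>M) - 1) \<le> 1 / 2"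
proof -
  have pos: "Im w > 0" "Im u > 0" using w u y by auto
  let ?A = "{x::real. K < \<bar>x\<bar>}"
  let ?f = "\<lambda>x. w * u * (1 / ((w - complex_of_real x) * (u - complex_of_real x))) - 1"
  have A: "?A \<in> sets borel" by measurable
  have int: "integrable M ?f"
    by (intro Bochner_Integration.integrable_diff integrable_mult_right integrable_cauchy_kernel_prod pos) simp
  have "norm (?f x) \<le> 3 * e + 3 * indicator ?A x" for x
  proof -
    define p where "p = complex_of_real x / (w - complex_of_real x)"
    define q where "q = complex_of_real x / (u - complex_of_real x)"
    have pq: "w / (w - complex_of_real x) = 1 + p" "u / (u - complex_of_real x) = 1 + q"
      unfolding p_def q_def by (intro cauchy_kernel_shift pos)+
    have f: "?f x = (1 + p) * (1 + q) - 1" unfolding pq[symmetric] by simp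
    show ?thesis
    proof (cases "x \<in> ?A")
      case True
      have "norm (1 + p) \<le> norm w / Im w" "norm (1 + q) \<le> norm u / Im u"
        unfolding pq[symmetric] by (intro norm_over_diff_of_real_le pos)+
      moreover have "norm w / Im w \<le> 2" "norm u / Im u \<le> 1" using w u y by (auto simp: divide_le_eq)
      ultimately have "norm (1 + p) * norm (1 + q) \<le> 2 * 1"
        by (intro mult_mono) auto
      then have "norm (?f x) \<le> 3"
        unfolding f using norm_triangle_ineq4[of "(1 + p) * (1 + q)" 1] by (simp add: norm_mult)
      then show ?thesis using True e by simp
    next
      case False
      have "\<bar>x\<bar> / Im w \<le> K / y" "\<bar>x\<bar> / Im u \<le> K / y"
        using False w u y K by (auto intro!: frac_le)
      moreover have "K / y \<le> e" using K y by (simp add: field_simps)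
      ultimately have p: "norm p \<le> e" and q: "norm q \<le> e"
        unfolding p_def q_def using norm_of_real_over_diff_le[OF pos(1), of x] norm_of_real_over_diff_le[OF pos(2), of x]
        by linarith+
      have "?f x = p + q + p * q" unfolding f by (simp add: algebra_simps)
      then have "norm (?f x) \<le> norm p + norm q + norm p * norm q"
        by (metis norm_triangle_le norm_triangle_ineq norm_mult add_mono order_refl)
      also have "norm p * norm q \<le> e * 1" using p q e by (intro mult_mono) auto
      finally show ?thesis using p q False by simp
    qed
  qed
  then have "(\<integral>x. norm (?f x) \<partial>M) \<le> (\<integral>x. 3 * e + 3 * indicator ?A x \<partial>M)"
    using A int by (intro integral_mono) (auto simp: integrable_indicator_iff emeasure_eq_measure)
  also have "\<dots> = 3 * e + 3 * measure M ?A"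
    using A by (subst Bochner_Integration.integral_add) (auto simp: prob_space integrable_indicator_iff emeasure_eq_measure prob_space[simplified])
  also have "\<dots> \<le> 1 / 2" using tail e by simp
  finally have *: "(\<integral>x. norm (?f x) \<partial>M) \<le> 1 / 2" .
  have "(\<integral>x. ?f x \<partial>M) = w * u * (\<integral>x. 1 / ((w - complex_of_real x) * (u - complex_of_real x)) \<partial>M) - 1"
    by (subst Bochner_Integration.integral_diff)
       (intro integrable_mult_right integrable_cauchy_kernel_prod pos integrable_const
         | simp only: integral_mult_right_zero lebesgue_integral_const prob_space scaleR_one)+
  then show ?thesis using * integral_norm_bound[of M ?f] by simp
qed

section \<open>Monotonicity in the scale\<close>

lemma ii_cauchy_transform_mono:
  assumes "0 < y" "y \<le> y'"
  shows "Re (\<i> * complex_of_real y * cauchy_transform M (\<i> * complex_of_real y))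
    \<le> Re (\<i> * complex_of_real y' * cauchy_transform M (\<i> * complex_of_real y'))"
proof -
  have "y\<^sup>2 / (x\<^sup>2 + y\<^sup>2) \<le> y'\<^sup>2 / (x\<^sup>2 + y'\<^sup>2)" for x
  proof -
    have "y\<^sup>2 \<le> y'\<^sup>2" using assms by (intro power_mono) auto
    then have "y\<^sup>2 * (x\<^sup>2 + y'\<^sup>2) \<le> y'\<^sup>2 * (x\<^sup>2 + y\<^sup>2)"
      using mult_right_mono[of "y\<^sup>2" "y'\<^sup>2" "x\<^sup>2"] by (simp add: algebra_simps)
    then show ?thesis using assms by (intro frac_le_eq[THEN iffD2] | simp add: divide_le_eq le_divide_eq add_nonneg_pos)+
  qed
  then show ?thesis
    unfolding Re_ii_cauchy_transform[OF assms(1)] Re_ii_cauchy_transform[OF less_le_trans[OF assms]]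
    using assms by (intro integral_mono integrable_sq_over_sum) auto
qed

text \<open>The integrand y^2 / (x^2 + y^2) increases strictly in y for every x except 0, where it
  is constantly 1. Hence strictness fails only for a law without mass off 0.\<close>

lemma ii_cauchy_transform_strict_mono:
  assumes "0 < y" "y < y'" "M \<noteq> return borel 0"
  shows "Re (\<i> * complex_of_real y * cauchy_transform M (\<i> * complex_of_real y))
    < Re (\<i> * complex_of_real y' * cauchy_transform M (\<i> * complex_of_real y'))"
proof -
  have y': "y' > 0" using assms by simp
  have lt: "y\<^sup>2 / (x\<^sup>2 + y\<^sup>2) < y'\<^sup>2 / (x\<^sup>2 + y'\<^sup>2)" if "x \<noteq> 0" for x
  proof -
    have "y\<^sup>2 < y'\<^sup>2" using assms by (intro power_strict_mono) auto
    then have "y\<^sup>2 * x\<^sup>2 < y'\<^sup>2 * x\<^sup>2" using that by (intro mult_strict_right_mono) auto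
    then have "y\<^sup>2 * (x\<^sup>2 + y'\<^sup>2) < y'\<^sup>2 * (x\<^sup>2 + y\<^sup>2)" by (simp add: algebra_simps)
    moreover have "x\<^sup>2 + y\<^sup>2 > 0" "x\<^sup>2 + y'\<^sup>2 > 0" using that by (auto intro: add_pos_nonneg)
    ultimately show ?thesis by (simp only: divide_less_eq less_divide_eq if_True times_divide_eq_left)
  qed
  have nz: "emeasure M (- {0}) \<noteq> 0"
  proof
    assume "emeasure M (- {0}) = 0"
    then have ae: "AE x in M. x = 0" by (intro AE_I[of _ _ "- {0}"]) auto
    have "M = return borel 0"
    proof (rule cauchy_transform_unique[OF real_distribution_axioms real_distribution_return])
      fix z
      have "(\<integral>x. 1 / (z - complex_of_real x) \<partial>M) = (\<integral>x. 1 / z \<partial>M)"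
        by (intro integral_cong_AE) (use ae in auto)
      also have "\<dots> = 1 / z" by (simp only: lebesgue_integral_const prob_space scaleR_one)
      finally show "cauchy_transform M z = cauchy_transform (return borel 0) z"
        unfolding cauchy_transform_return unfolding cauchy_transform_def by simp
    qed
    then show False using assms(3) by simp
  qed
  show ?thesis
    unfolding Re_ii_cauchy_transform[OF assms(1)] Re_ii_cauchy_transform[OF y']
  proof (rule integral_less_AE[OF integrable_sq_over_sum[OF assms(1)] integrable_sq_over_sum[OF y'] nz])
    show "AE x in M. x \<in> - {0} \<longrightarrow> y\<^sup>2 / (x\<^sup>2 + y\<^sup>2) \<noteq> y'\<^sup>2 / (x\<^sup>2 + y'\<^sup>2)"
      using lt by (intro AE_I2) (metis ComplD insertI1 less_irrefl singletonI)
    have "y\<^sup>2 / (x\<^sup>2 + y\<^sup>2) \<le> y'\<^sup>2 / (x\<^sup>2 + y'\<^sup>2)" for x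
      using lt[of x] assms(1) y' by (cases "x = 0") auto
    then show "AE x in M. y\<^sup>2 / (x\<^sup>2 + y\<^sup>2) \<le> y'\<^sup>2 / (x\<^sup>2 + y'\<^sup>2)" by simp
  qed auto
qed

end

text \<open>At u = iy, F_S(u) / u tends to F_\<mu>(u) / u, which is close to 1 for large
  \<open>y\<close>; the preimage estimate then applies to v = F_S(u) and w = F_N(u), whose height is
  at least \<open>y\<close>. The clause \<open>K \<le> e * y\<close> is exported so that further
  estimates can be made at the same height.\<close>

lemma right_factor_near_identity:
  assumes S: "\<And>n. real_distribution (S n)" and L: "\<And>n. real_distribution (L n)"
    and N: "\<And>n. real_distribution (N n)" and \<mu>: "real_distribution \<mu>"
    and comp: "\<And>n z. Im z > 0 \<Longrightarrow> F_transform (S n) z = F_transform (L n) (F_transform (N n) z)"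
    and lim: "\<And>z. Im z > 0 \<Longrightarrow> (\<lambda>n. cauchy_transform (S n) z) \<longlonglongrightarrow> cauchy_transform \<mu> z"
    and e: "0 < e" "e \<le> 1 / 12"
    and K: "0 \<le> K" and tail: "\<forall>\<^sub>F n in sequentially. measure (L n) {x. K < \<bar>x\<bar>} \<le> e"
  shows "\<exists>y>0. K \<le> e * y \<and> (\<forall>\<^sub>F n in sequentially.
    norm (F_transform (N n) (\<i> * complex_of_real y) / (\<i> * complex_of_real y) - 1) \<le> 6 * e)"
proof -
  interpret \<mu>: real_distribution \<mu> by fact
  define k where "k = (\<lambda>y. \<i> * complex_of_real y * cauchy_transform \<mu> (\<i> * complex_of_real y))"
  have "((\<lambda>y. 1 / k y) \<longlongrightarrow> 1 / 1) at_top"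
    unfolding k_def by (intro tendsto_divide tendsto_const \<mu>.ii_cauchy_transform_tendsto_1) simp
  then have "\<forall>\<^sub>F y in at_top. dist (1 / k y) 1 < e" using e by (intro tendstoD) auto
  from eventually_happens'[OF _ eventually_conj[OF this
      eventually_conj[OF eventually_gt_at_top[of 0] eventually_ge_at_top[of "K / e"]]]]
  obtain y where y: "dist (1 / k y) 1 < e" "y > 0" "K / e \<le> y" by auto
  define u where "u = \<i> * complex_of_real y"
  have u: "Im u > 0" "u \<noteq> 0" "Im u = y" using y by (auto simp: u_def)
  have K': "K \<le> e * y" using y e by (simp add: field_simps)
  have "(\<lambda>n. F_transform (S n) u / u) \<longlonglongrightarrow> F_transform \<mu> u / u"
    by (intro tendsto_divide tendsto_const F_transform_tendsto[OF \<mu> u(1) lim[OF u(1)]] u)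
  moreover have "F_transform \<mu> u / u = 1 / k y" by (simp add: k_def u_def F_transform_def)
  ultimately have "(\<lambda>n. dist (F_transform (S n) u / u) 1) \<longlonglongrightarrow> dist (1 / k y) 1"
    by (simp add: tendsto_dist)
  then have "\<forall>\<^sub>F n in sequentially. dist (F_transform (S n) u / u) 1 < e"
    using y(1) by (rule order_tendstoD)
  then have "\<forall>\<^sub>F n in sequentially. norm (F_transform (N n) u / u - 1) \<le> 6 * e"
    using tail
  proof eventually_elim
    case (elim n)
    interpret L: real_distribution "L n" by (rule L)
    interpret N: real_distribution "N n" by (rule N)
    have w: "Im (F_transform (N n) u) \<ge> y" using N.Im_F_transform_ge[OF u(1)] u by simp
    have "cauchy_transform (L n) (F_transform (N n) u) \<noteq> 0"
      using w y(2) by (intro L.cauchy_transform_nonzero) simp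
    then have "F_transform (S n) u * cauchy_transform (L n) (F_transform (N n) u) = 1"
      unfolding comp[OF u(1)] by (simp add: F_transform_def)
    from L.F_transform_preimage_estimate[OF e y(2) K K' elim(2) w this] elim(1)
    show ?case by (simp add: u_def dist_norm)
  qed
  then show ?thesis using y(2) K' by (auto simp: u_def)
qed

lemma right_factor_tails:
  assumes S: "\<And>n. real_distribution (S n)" and L: "\<And>n. real_distribution (L n)"
    and N: "\<And>n. real_distribution (N n)" and \<mu>: "real_distribution \<mu>"
    and comp: "\<And>n z. Im z > 0 \<Longrightarrow> F_transform (S n) z = F_transform (L n) (F_transform (N n) z)"
    and lim: "\<And>z. Im z > 0 \<Longrightarrow> (\<lambda>n. cauchy_transform (S n) z) \<longlonglongrightarrow> cauchy_transform \<mu> z"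
    and tail: "\<And>e. e > 0 \<Longrightarrow> \<exists>K>0. \<forall>\<^sub>F n in sequentially. measure (L n) {x. K < \<bar>x\<bar>} \<le> e"
    and d: "d > 0"
  shows "\<exists>K>0. \<forall>\<^sub>F n in sequentially. measure (N n) {x. K < \<bar>x\<bar>} \<le> d"
proof -
  \<comment> \<open>F_N(u) / u lies within 6 e of 1, its inverse u G_N(u) within 12 e, and the tail
    inequality doubles this to 24 e.\<close>
  define e where "e = min (1 / 12) (d / 24)"
  have e: "0 < e" "e \<le> 1 / 12" "24 * e \<le> d" using d by (auto simp: e_def)
  obtain K where K: "K > 0" "\<forall>\<^sub>F n in sequentially. measure (L n) {x. K < \<bar>x\<bar>} \<le> e"
    using tail[OF e(1)] by auto
  obtain y where y: "y > 0" and near: "\<forall>\<^sub>F n in sequentially.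
      norm (F_transform (N n) (\<i> * complex_of_real y) / (\<i> * complex_of_real y) - 1) \<le> 6 * e"
    using right_factor_near_identity[OF S L N \<mu> comp lim e(1,2) less_imp_le[OF K(1)] K(2)] by auto
  from near have "\<forall>\<^sub>F n in sequentially. measure (N n) {x. y < \<bar>x\<bar>} \<le> d"
  proof eventually_elim
    case (elim n)
    interpret N: real_distribution "N n" by (rule N)
    define u where "u = \<i> * complex_of_real y"
    define q where "q = F_transform (N n) u / u"
    have u: "Im u > 0" "u \<noteq> 0" using y by (auto simp: u_def)
    have q: "norm (q - 1) \<le> 6 * e" using elim by (simp add: q_def u_def)
    have uG: "u * cauchy_transform (N n) u = 1 / q" by (simp add: q_def F_transform_def)
    have q2: "norm q \<ge> 1 / 2"
      using q e norm_triangle_ineq2[of 1 "1 - q"] by (simp add: norm_minus_commute)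
    then have "q \<noteq> 0" by auto
    then have "1 - 1 / q = (q - 1) / q" by (simp add: diff_divide_distrib)
    then have "norm (1 - 1 / q) = norm (q - 1) / norm q" by (simp add: norm_divide)
    also have "\<dots> \<le> 6 * e / (1 / 2)" using q q2 e by (intro frac_le) auto
    finally have "norm (1 - 1 / q) \<le> 12 * e" by simp
    with complex_Re_le_cmod have "Re (1 - 1 / q) \<le> 12 * e" by (rule order_trans)
    moreover have "measure (N n) {x. y < \<bar>x\<bar>} \<le> (1 + y\<^sup>2 / y\<^sup>2) * (1 - Re (u * cauchy_transform (N n) u))"
      unfolding u_def by (rule N.measure_tail_le[OF y y])
    ultimately show ?case using e(3) y unfolding uG by simp
  qed
  then show ?thesis using y by blast
qed

text \<open>Here the cut-off is small instead of large: K = e Im z / 3 bounds the central part by e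
  / 3, and the mass outside tends to 0.\<close>

lemma F_transform_tendsto_identity:
  assumes T: "\<And>n. real_distribution (T n)"
    and tail: "\<And>d. d > 0 \<Longrightarrow> (\<lambda>n. measure (T n) {x. d < \<bar>x\<bar>}) \<longlonglongrightarrow> 0"
    and z: "Im z > 0"
  shows "(\<lambda>n. F_transform (T n) z) \<longlonglongrightarrow> z"
proof -
  have "(\<lambda>n. z * cauchy_transform (T n) z) \<longlonglongrightarrow> 1"
  proof (rule tendstoI)
    fix e :: real assume e: "e > 0"
    define C where "C = 1 + norm z / Im z"
    have C: "C > 0" using z by (auto simp: C_def intro!: add_pos_nonneg)
    have "\<forall>\<^sub>F n in sequentially. measure (T n) {x. e * Im z / 3 < \<bar>x\<bar>} < e / (3 * C)"
      using e z C by (intro order_tendstoD(2)[OF tail]) auto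
    then show "\<forall>\<^sub>F n in sequentially. dist (z * cauchy_transform (T n) z) 1 < e"
    proof eventually_elim
      case (elim n)
      have "norm (z * cauchy_transform (T n) z - 1) \<le> e * Im z / 3 / Im z + e / (3 * C) * C"
        unfolding C_def
        by (intro real_distribution.norm_mult_cauchy_transform_le T z) (use elim e z C in \<open>auto simp: C_def\<close>)
      also have "\<dots> = e / 3 + e / 3" using C z by (simp add: field_simps)
      finally show ?case using e by (simp add: dist_norm)
    qed
  qed
  then have "(\<lambda>n. z / (z * cauchy_transform (T n) z)) \<longlonglongrightarrow> z / 1" by (intro tendsto_intros) auto
  moreover have "z \<noteq> 0" using z by auto
  ultimately show ?thesis by (simp add: F_transform_def)
qed

text \<open>A convergence-of-types argument. Evaluating the dilated law at height 1 is evaluating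
  \<open>S n\<close> at height \<open>1 / a n\<close>. Were \<open>a n\<close> \<le> l < 1 for
  infinitely many n, monotonicity would push the limit up to \<open>h \<mu> (1 / l)\<close>, which
  exceeds \<open>h \<mu> 1\<close>; l > 1 is symmetric. Strictness is used only for the limit
  law.\<close>

lemma dilation_ratio_tendsto_1:
  assumes S: "\<And>n. real_distribution (S n)" and \<mu>: "real_distribution \<mu>" "\<mu> \<noteq> return borel 0"
    and a: "\<And>n. a n > 0"
    and lim: "\<And>z. Im z > 0 \<Longrightarrow> (\<lambda>n. cauchy_transform (S n) z) \<longlonglongrightarrow> cauchy_transform \<mu> z"
    and lim_a: "\<And>z. Im z > 0 \<Longrightarrow> (\<lambda>n. cauchy_transform (dilation (a n) (S n)) z) \<longlonglongrightarrow> cauchy_transform \<mu> z"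
  shows "a \<longlonglongrightarrow> 1"
proof -
  define h where "h = (\<lambda>M y. Re (\<i> * complex_of_real y * cauchy_transform M (\<i> * complex_of_real y)))"
  have h_lim: "(\<lambda>n. h (S n) y) \<longlonglongrightarrow> h \<mu> y" if "y > 0" for y
    unfolding h_def using that by (intro tendsto_Re tendsto_mult_left lim) auto
  have "h (S n) (1 / a n) = Re (\<i> * cauchy_transform (dilation (a n) (S n)) \<i>)" for n
    by (simp add: h_def cauchy_transform_dilation[OF S a])
  moreover have "(\<lambda>n. Re (\<i> * cauchy_transform (dilation (a n) (S n)) \<i>)) \<longlonglongrightarrow> h \<mu> 1"
    unfolding h_def of_real_1 mult_1_right by (intro tendsto_Re tendsto_mult_left lim_a) auto
  ultimately have h_a: "(\<lambda>n. h (S n) (1 / a n)) \<longlonglongrightarrow> h \<mu> 1" by simp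
  have strict: "h \<mu> y < h \<mu> y'" if "0 < y" "y < y'" for y y'
    unfolding h_def by (rule real_distribution.ii_cauchy_transform_strict_mono[OF \<mu>(1) that \<mu>(2)])
  have mono: "h (S n) y \<le> h (S n) y'" if "0 < y" "y \<le> y'" for n y y'
    unfolding h_def by (rule real_distribution.ii_cauchy_transform_mono[OF S that])
  show ?thesis
  proof (rule order_tendstoI)
    fix l :: real assume l: "l < 1"
    show "\<forall>\<^sub>F n in sequentially. l < a n"
    proof (cases "l > 0")
      case True
      obtain m where m: "h \<mu> 1 < m" "m < h \<mu> (1 / l)" using strict[of 1 "1 / l"] True l dense by auto
      have "\<forall>\<^sub>F n in sequentially. h (S n) (1 / a n) < m" by (rule order_tendstoD(2)[OF h_a m(1)])
      moreover have "\<forall>\<^sub>F n in sequentially. m < h (S n) (1 / l)"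
        using True m(2) by (intro order_tendstoD(1)[OF h_lim]) auto
      ultimately show ?thesis
      proof eventually_elim
        case (elim n)
        then have "\<not> 1 / l \<le> 1 / a n" using mono[of "1 / l" "1 / a n" n] True by auto
        then show ?case using True a[of n] by (simp add: field_simps)
      qed
    next
      case False
      then have "l < a n" for n using a[of n] by linarith
      then show ?thesis by simp
    qed
  next
    fix l :: real assume l: "1 < l"
    obtain m where m: "h \<mu> (1 / l) < m" "m < h \<mu> 1" using strict[of "1 / l" 1] l dense by auto
    have "\<forall>\<^sub>F n in sequentially. m < h (S n) (1 / a n)" by (rule order_tendstoD(1)[OF h_a m(2)])
    moreover have "\<forall>\<^sub>F n in sequentially. h (S n) (1 / l) < m"
      using l m(1) by (intro order_tendstoD(2)[OF h_lim]) auto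
    ultimately show "\<forall>\<^sub>F n in sequentially. a n < l"
    proof eventually_elim
      case (elim n)
      then have "\<not> 1 / a n \<le> 1 / l" using mono[of "1 / a n" "1 / l" n] a[of n] by auto
      then show ?case using l a[of n] by (simp add: field_simps)
    qed
  qed
qed

subsection \<open>Limit laws are selfdecomposable\<close>

lemma real_distribution_monotone_conv_upto:
  assumes "\<And>k. k \<ge> 1 \<Longrightarrow> real_distribution (\<nu> k)"
  shows "real_distribution (monotone_conv_upto \<nu> n)"
  using assms
proof (induction \<nu> n rule: monotone_conv_upto.induct)
  case (3 \<nu> n)
  then show ?case by (simp add: monotone_conv_spec(1))
qed (auto simp: real_distribution_return)

lemma F_transform_monotone_conv_upto_Suc:
  assumes "\<And>k. k \<ge> 1 \<Longrightarrow> real_distribution (\<nu> k)" "Im z > 0"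
  shows "F_transform (monotone_conv_upto \<nu> (Suc n)) z
    = F_transform (monotone_conv_upto \<nu> n) (F_transform (\<nu> (Suc n)) z)"
proof (cases n)
  case 0
  then show ?thesis by (simp add: F_transform_return_0)
next
  case (Suc m)
  then show ?thesis
    using real_distribution_monotone_conv_upto[of \<nu> n] assms
    by (simp add: monotone_conv_spec(2))
qed

text \<open>With bracketing to the left, the block of factors after \<open>m\<close> is not a
  subterm. The induction builds it by appending factors on the right, associativity being that of
  composition; the empty block is the point mass at 0.\<close>

lemma monotone_conv_upto_tail:
  assumes \<nu>: "\<And>k. k \<ge> 1 \<Longrightarrow> real_distribution (\<nu> k)" and "m \<le> n"
  shows "\<exists>\<kappa>. real_distribution \<kappa> \<and> (\<forall>z. Im z > 0 \<longrightarrow> F_transform (monotone_conv_upto \<nu> n) z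
      = F_transform (monotone_conv_upto \<nu> m) (F_transform \<kappa> z))"
  using \<open>m \<le> n\<close>
proof (induction n rule: dec_induct)
  case base
  show ?case by (intro exI[of _ "return borel 0"]) (simp add: real_distribution_return F_transform_return_0)
next
  case (step n)
  then obtain \<kappa> where \<kappa>: "real_distribution \<kappa>"
    "\<And>z. Im z > 0 \<Longrightarrow> F_transform (monotone_conv_upto \<nu> n) z
      = F_transform (monotone_conv_upto \<nu> m) (F_transform \<kappa> z)" by auto
  have \<nu>n: "real_distribution (\<nu> (Suc n))" by (rule \<nu>) simp
  show ?case
  proof (intro exI[of _ "\<kappa> \<rhd> \<nu> (Suc n)"] conjI allI impI)
    show "real_distribution (\<kappa> \<rhd> \<nu> (Suc n))" by (rule monotone_conv_spec(1)[OF \<kappa>(1) \<nu>n])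
    fix z :: complex assume z: "Im z > 0"
    have "Im (F_transform (\<nu> (Suc n)) z) > 0" by (rule real_distribution.Im_F_transform_pos[OF \<nu>n z])
    then show "F_transform (monotone_conv_upto \<nu> (Suc n)) z
      = F_transform (monotone_conv_upto \<nu> m) (F_transform (\<kappa> \<rhd> \<nu> (Suc n)) z)"
      using F_transform_monotone_conv_upto_Suc[of \<nu> z n] \<nu> z
      by (simp add: monotone_conv_spec(2)[OF \<kappa>(1) \<nu>n z] \<kappa>(2) del: monotone_conv_upto.simps)
  qed
qed

section \<open>Dilation rules and infinitesimal arrays\<close>

lemma measure_dilation_tail:
  assumes "real_distribution \<mu>"
  shows "measure (dilation c \<mu>) {x. d < \<bar>x\<bar>} = measure \<mu> {x. d < \<bar>c * x\<bar>}"
proof -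
  interpret real_distribution \<mu> by fact
  show ?thesis unfolding dilation_def by (subst measure_distr) auto
qed

lemma dilation_dilation:
  assumes "real_distribution \<mu>" shows "dilation a (dilation b \<mu>) = dilation (a * b) \<mu>"
proof -
  interpret real_distribution \<mu> by fact
  show ?thesis unfolding dilation_def by (subst distr_distr) (auto simp: o_def mult.assoc[symmetric])
qed

lemma dilation_1:
  assumes "real_distribution \<mu>" shows "dilation 1 \<mu> = \<mu>"
proof -
  interpret real_distribution \<mu> by fact
  show ?thesis unfolding dilation_def mult_1_left by (rule distr_id2) simp
qed

lemma dilation_return_0: "dilation c (return borel 0) = return borel 0"
  unfolding dilation_def by (subst distr_return) auto

lemma monotonically_selfdecomposable_return_0: "monotonically_selfdecomposable (return borel 0)"
  unfolding monotonically_selfdecomposable_def dilation_return_0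
  by (auto intro!: exI[of _ "return borel 0"] real_distribution_return monotone_conv_spec(3)
      simp: F_transform_return_0)

lemma tail_set_eq: "UNIV - {- d..d} = {x::real. d < \<bar>x\<bar>}"
  by auto

text \<open>Selects one entry from each row. A constant index \<open>j n = k\<close> will force the
  scales to 0, and the diagonal \<open>j n = n\<close> makes the last factor negligible.\<close>

lemma infinitesimal_array_tail:
  assumes inf: "infinitesimal_array k M" and j: "\<forall>\<^sub>F n in sequentially. j n \<in> {1..k n}" and d: "d > 0"
  shows "(\<lambda>n. measure (M n (j n)) {x. d < \<bar>x\<bar>}) \<longlonglongrightarrow> 0"
proof (rule tendsto_sandwich[OF _ _ tendsto_const])
  show "(\<lambda>n. SUP j\<in>{1..k n}. measure (M n j) (UNIV - {-d..d})) \<longlonglongrightarrow> 0"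
    using inf d by (simp add: infinitesimal_array_def)
  show "\<forall>\<^sub>F n in sequentially. measure (M n (j n)) {x. d < \<bar>x\<bar>}
    \<le> (SUP j\<in>{1..k n}. measure (M n j) (UNIV - {-d..d}))"
    using j
  proof eventually_elim
    case (elim n)
    show ?case unfolding tail_set_eq by (rule cSUP_upper[OF elim]) (auto intro: bdd_above_finite)
  qed
qed simp

text \<open>The largest index \<open>m \<le> n\<close> with \<open>b n / b m \<le> c\<close> has ratio close to \<open>c\<close>, because consecutive
  ratios tend to one.\<close>

lemma ratio_index:
  fixes b :: "nat \<Rightarrow> real"
  assumes b: "\<And>n. b n > 0" "b \<longlonglongrightarrow> 0" "(\<lambda>n. b (Suc n) / b n) \<longlonglongrightarrow> 1" and c: "0 < c" "c < 1"
  obtains m where "\<And>n. m n \<le> n" "filterlim m at_top sequentially" "(\<lambda>n. b n / b (m n)) \<longlonglongrightarrow> c"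
proof -
  define A where "A = (\<lambda>n. {j\<in>{1..n}. b n \<le> c * b j})"
  \<comment> \<open>The value 0 for empty \<open>A n\<close> occurs only finitely often, since
    eventually 1 belongs to \<open>A n\<close>.\<close>
  define m where "m = (\<lambda>n. if A n = {} then 0 else Max (A n))"
  have fin: "finite (A n)" for n by (simp add: A_def)
  have m_in: "m n \<in> A n" if "A n \<noteq> {}" for n using that fin Max_in by (simp add: m_def)
  have m_ge: "j \<le> m n" if "j \<in> A n" for j n using that fin by (auto simp: m_def)
  have ev: "\<forall>\<^sub>F n in sequentially. j \<in> A n" if "j \<ge> 1" for j
  proof -
    have "\<forall>\<^sub>F n in sequentially. b n < c * b j" using b c by (intro order_tendstoD(2)[OF b(2)]) auto
    with eventually_ge_at_top[of j] show ?thesis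
      by eventually_elim (use that in \<open>auto simp: A_def\<close>)
  qed
  have m_le: "m n \<le> n" for n
    using m_in[of n] by (cases "A n = {}") (auto simp: m_def A_def)
  have m_top: "filterlim m at_top sequentially"
    unfolding filterlim_at_top
  proof
    fix Z
    have "\<forall>\<^sub>F n in sequentially. max 1 Z \<in> A n" by (rule ev) simp
    then show "\<forall>\<^sub>F n in sequentially. Z \<le> m n" by eventually_elim (use m_ge in force)
  qed
  have "(\<lambda>n. b n / b (m n)) \<longlonglongrightarrow> c"
  proof (rule tendsto_sandwich[OF _ _ _ tendsto_const])
    have "(\<lambda>n. c * (b (Suc (m n)) / b (m n))) \<longlonglongrightarrow> c * 1"
      by (intro tendsto_mult_left filterlim_compose[OF b(3) m_top])
    then show "(\<lambda>n. c * (b (Suc (m n)) / b (m n))) \<longlonglongrightarrow> c" by simp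
    have "\<forall>\<^sub>F n in sequentially. 1 \<in> A n" by (rule ev) simp
    then show "\<forall>\<^sub>F n in sequentially. b n / b (m n) \<le> c"
    proof eventually_elim
      case (elim n)
      then have "m n \<in> A n" using m_in by auto
      then show ?case using b(1)[of "m n"] by (simp add: A_def field_simps)
    qed
    show "\<forall>\<^sub>F n in sequentially. c * (b (Suc (m n)) / b (m n)) \<le> b n / b (m n)"
      using \<open>\<forall>\<^sub>F n in sequentially. 1 \<in> A n\<close>
    proof eventually_elim
      case (elim n)
      then have mA: "m n \<in> A n" using m_in by auto
      have "c * b (Suc (m n)) \<le> b n"
      \<comment> \<open>If \<open>m n < n\<close>, the successor of the maximum violates the
        inequality that defines \<open>A n\<close>, which is the claim; \<open>m n = n\<close> would
        give b n \<le> c b n, which is impossible.\<close>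
      proof (cases "m n = n")
        case True
        have "c * b n < 1 * b n" using b(1) c by (intro mult_strict_right_mono) auto
        then show ?thesis using mA True by (simp add: A_def)
      next
        case False
        then have "Suc (m n) \<in> {1..n}" using m_le[of n] by auto
        moreover have "Suc (m n) \<notin> A n" using m_ge[of "Suc (m n)" n] by auto
        ultimately show ?thesis by (auto simp: A_def)
      qed
      then show ?case using b(1)[of "m n"] by (simp add: divide_right_mono)
    qed
  qed
  then show ?thesis using that m_le m_top by blast
qed

theorem limit_imp_monotonically_selfdecomposable:
  fixes \<mu> :: "real measure" and b :: "nat \<Rightarrow> real" and \<nu> :: "nat \<Rightarrow> real measure"
  assumes \<mu>: "real_distribution \<mu>" and b: "\<And>n. b n > 0"
    and \<nu>: "\<And>n. n \<ge> 1 \<Longrightarrow> real_distribution (\<nu> n)"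
    and inf: "infinitesimal_array (\<lambda>n. n) (\<lambda>n k. dilation (b n) (\<nu> k))"
    and conv: "weak_conv_m (\<lambda>n. dilation (b n) (monotone_conv_upto \<nu> n)) \<mu>"
  shows "monotonically_selfdecomposable \<mu>"
\<comment> \<open>The point mass at 0 is invariant under dilation, so its scale cannot be recovered;
  it is its own cofactor instead.\<close>
proof (cases "\<mu> = return borel 0")
  case True
  then show ?thesis by (simp add: monotonically_selfdecomposable_return_0)
next
  case False
  define P where "P = monotone_conv_upto \<nu>"
  define S where "S = (\<lambda>n. dilation (b n) (P n))"
  have P: "real_distribution (P n)" for n
    unfolding P_def by (rule real_distribution_monotone_conv_upto[OF \<nu>])
  have S: "real_distribution (S n)" for n unfolding S_def by (rule real_distribution_dilation[OF P])
  have lim: "(\<lambda>n. cauchy_transform (S n) z) \<longlonglongrightarrow> cauchy_transform \<mu> z" if "Im z > 0" for z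
    using weak_conv_m_imp_cauchy_transform[OF S \<mu> _ that] conv by (simp add: S_def P_def)
  have FS: "F_transform (S n) z = complex_of_real (b n) * F_transform (P n) (z / complex_of_real (b n))" for n z
    unfolding S_def by (rule F_transform_dilation[OF P b])
  have Im_div: "Im (z / complex_of_real r) > 0" if "Im z > 0" "r > 0" for z r
    using that by simp

  have b_0: "b \<longlonglongrightarrow> 0"
  proof -
    \<comment> \<open>If every \<nu>_k were the point mass at 0, so would be \<mu>. A single factor
      with mass beyond \<open>t\<close> then suffices: its dilations lie in all later rows of the
      array, and a scale \<open>b n\<close> \<ge> l would keep that mass beyond l t.\<close>
    have "\<exists>k\<ge>1. \<exists>t>0. measure (\<nu> k) {x. t < \<bar>x\<bar>} > 0"
    proof (rule ccontr)
      assume no: "\<not> ?thesis"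
      have "\<nu> k = return borel 0" if k: "k \<ge> 1" for k
      proof (rule cauchy_transform_unique[OF \<nu>[OF k] real_distribution_return])
        fix z :: complex assume z: "Im z > 0"
        have "(\<lambda>_::nat. F_transform (\<nu> k) z) \<longlonglongrightarrow> z"
        proof (rule F_transform_tendsto_identity[OF \<nu>[OF k] _ z])
          fix d :: real assume "d > 0"
          then have "measure (\<nu> k) {x. d < \<bar>x\<bar>} = 0"
            using no k measure_nonneg[of "\<nu> k" "{x. d < \<bar>x\<bar>}"] by (metis less_eq_real_def)
          then show "(\<lambda>_::nat. measure (\<nu> k) {x. d < \<bar>x\<bar>}) \<longlonglongrightarrow> 0" by simp
        qed
        then have "F_transform (\<nu> k) z = F_transform (return borel 0) z"
          by (simp add: LIMSEQ_const_iff F_transform_return_0)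
        then show "cauchy_transform (\<nu> k) z = cauchy_transform (return borel 0) z"
          by (simp add: F_transform_eq_iff)
      qed
      then have F_P: "F_transform (P n) z = z" if "Im z > 0" for n z
        unfolding P_def using that
      proof (induction n)
        case (Suc n)
        then show ?case
          using F_transform_monotone_conv_upto_Suc[of \<nu> z n] \<nu> \<open>\<And>k. k \<ge> 1 \<Longrightarrow> \<nu> k = return borel 0\<close>[of "Suc n"]
          by (simp add: F_transform_return_0 del: monotone_conv_upto.simps)
      qed (simp add: F_transform_return_0)
      have "\<mu> = return borel 0"
      proof (rule cauchy_transform_unique[OF \<mu> real_distribution_return])
        fix z :: complex assume z: "Im z > 0"
        have "F_transform (S n) z = F_transform (return borel 0) z" for n
          unfolding FS using F_P[OF Im_div[OF z b]] b[of n] by (simp add: F_transform_return_0)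
        then have "cauchy_transform (S n) z = cauchy_transform (return borel 0) z" for n
          by (simp only: F_transform_eq_iff)
        then show "cauchy_transform \<mu> z = cauchy_transform (return borel 0) z"
          using lim[OF z] by (simp add: LIMSEQ_const_iff)
      qed
      then show False using False by simp
    qed
    then obtain k t where k: "k \<ge> 1" and t: "t > 0" "measure (\<nu> k) {x. t < \<bar>x\<bar>} > 0" by blast
    interpret \<nu>k: real_distribution "\<nu> k" by (rule \<nu>[OF k])
    show ?thesis
    proof (rule order_tendstoI)
      fix l :: real assume "l < 0"
      then have "l < b n" for n using b[of n] by linarith
      then show "\<forall>\<^sub>F n in sequentially. l < b n" by simp
    next
      fix l :: real assume l: "0 < l"
      have "(\<lambda>n. measure (dilation (b n) (\<nu> k)) {x. l * t < \<bar>x\<bar>}) \<longlonglongrightarrow> 0"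
        using k l t by (intro infinitesimal_array_tail[OF inf]) (auto simp: eventually_ge_at_top)
      then have "\<forall>\<^sub>F n in sequentially. measure (dilation (b n) (\<nu> k)) {x. l * t < \<bar>x\<bar>} < measure (\<nu> k) {x. t < \<bar>x\<bar>}"
        using t(2) by (rule order_tendstoD)
      then show "\<forall>\<^sub>F n in sequentially. b n < l"
      proof eventually_elim
        case (elim n)
        show ?case
        proof (rule ccontr)
          assume "\<not> b n < l"
          then have "l * t < \<bar>b n * x\<bar>" if "t < \<bar>x\<bar>" for x
            using that l t mult_le_less_imp_less[of l "b n" t "\<bar>x\<bar>"] by (simp add: abs_mult)
          then have "measure (\<nu> k) {x. t < \<bar>x\<bar>} \<le> measure (\<nu> k) {x. l * t < \<bar>b n * x\<bar>}"
            by (intro \<nu>k.finite_measure_mono) auto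
          then show False using elim unfolding measure_dilation_tail[OF \<nu>[OF k]] by simp
        qed
      qed
    qed
  qed

  define a where "a = (\<lambda>n. b (Suc n) / b n)"
  have a: "a n > 0" for n using b by (simp add: a_def)
  have "a \<longlonglongrightarrow> 1"
  proof (rule dilation_ratio_tendsto_1[OF S \<mu> False a lim])
    fix z :: complex assume z: "Im z > 0"
    \<comment> \<open>\<open>T n\<close> is the last factor of \<open>S (Suc n)\<close>, and the
      remaining factors form \<open>dilation (a n) (S n)\<close>. Since \<open>T n\<close> tends to
      the point mass at 0, the two have the same limit.\<close>
    define T where "T = (\<lambda>n. dilation (b (Suc n)) (\<nu> (Suc n)))"
    have T: "real_distribution (T n)" for n unfolding T_def by (intro real_distribution_dilation \<nu>) simp
    have FT: "(\<lambda>n. F_transform (T n) z) \<longlonglongrightarrow> z"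
    proof (rule F_transform_tendsto_identity[OF T _ z])
      fix d :: real assume "d > 0"
      then have "(\<lambda>n. measure (dilation (b n) (\<nu> n)) {x. d < \<bar>x\<bar>}) \<longlonglongrightarrow> 0"
        by (intro infinitesimal_array_tail[OF inf]) (auto simp: eventually_ge_at_top)
      from LIMSEQ_Suc[OF this] show "(\<lambda>n. measure (T n) {x. d < \<bar>x\<bar>}) \<longlonglongrightarrow> 0" by (simp add: T_def)
    qed
    define L where "L = (\<lambda>n. dilation (a n) (S n))"
    have L: "real_distribution (L n)" for n unfolding L_def by (rule real_distribution_dilation[OF S])
    have comp: "cauchy_transform (S (Suc n)) z = cauchy_transform (L n) (F_transform (T n) z)" for n
    proof -
      have "F_transform (L n) (F_transform (T n) z)
        = complex_of_real (b (Suc n)) * F_transform (P n) (F_transform (\<nu> (Suc n)) (z / complex_of_real (b (Suc n))))"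
        unfolding L_def F_transform_dilation[OF S a] FS T_def F_transform_dilation[OF \<nu>[of "Suc n", simplified] b]
        using b[of n] b[of "Suc n"] by (simp add: a_def)
      also have "\<dots> = F_transform (S (Suc n)) z"
        unfolding FS P_def
        using F_transform_monotone_conv_upto_Suc[of \<nu> "z / complex_of_real (b (Suc n))" n] \<nu> Im_div[OF z b]
        by (simp del: monotone_conv_upto.simps)
      finally show ?thesis by (simp add: F_transform_def)
    qed
    \<comment> \<open>Makes the Lipschitz constant below independent of n.\<close>
    have Im_T: "Im (F_transform (T n) z) \<ge> Im z" for n
      by (rule real_distribution.Im_F_transform_ge[OF T z])
    have "norm (cauchy_transform (S (Suc n)) z - cauchy_transform (L n) z)
      \<le> norm (F_transform (T n) z - z) / (Im z * Im z)" for n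
    proof -
      have "norm (cauchy_transform (S (Suc n)) z - cauchy_transform (L n) z)
        \<le> norm (F_transform (T n) z - z) / (Im (F_transform (T n) z) * Im z)"
        unfolding comp using Im_T[of n] z by (intro real_distribution.cauchy_transform_lipschitz[OF L]) auto
      also have "\<dots> \<le> norm (F_transform (T n) z - z) / (Im z * Im z)"
        using Im_T[of n] z by (intro divide_left_mono mult_right_mono mult_pos_pos) auto
      finally show ?thesis .
    qed
    then have bound: "\<forall>\<^sub>F n in sequentially. norm (cauchy_transform (S (Suc n)) z - cauchy_transform (L n) z)
      \<le> norm (F_transform (T n) z - z) / (Im z * Im z)" by simp
    have "(\<lambda>n. norm (F_transform (T n) z - z) / (Im z * Im z)) \<longlonglongrightarrow> norm (z - z) / (Im z * Im z)"
      using z by (intro tendsto_divide tendsto_const tendsto_norm tendsto_diff FT) auto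
    then have "(\<lambda>n. norm (F_transform (T n) z - z) / (Im z * Im z)) \<longlonglongrightarrow> 0" by simp
    from tendsto_diff[OF LIMSEQ_Suc[OF lim[OF z]] Lim_null_comparison[OF bound this]]
    show "(\<lambda>n. cauchy_transform (dilation (a n) (S n)) z) \<longlonglongrightarrow> cauchy_transform \<mu> z"
      by (simp add: L_def)
  qed

  show ?thesis
    unfolding monotonically_selfdecomposable_def
  proof (intro conjI allI impI \<mu>)
    fix c :: real assume "0 < c \<and> c < 1"
    then have c: "0 < c" "c < 1" by auto
    obtain m where m: "\<And>n. m n \<le> n" "filterlim m at_top sequentially" "(\<lambda>n. b n / b (m n)) \<longlonglongrightarrow> c"
      using ratio_index[of b c] b b_0 \<open>a \<longlonglongrightarrow> 1\<close> c unfolding a_def by blast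
    \<comment> \<open>The left block at scale \<open>b n\<close>: dilating \<open>P (m n)\<close> by
      \<open>b n\<close> is dilating \<open>S (m n)\<close> by the ratio. \<open>N n\<close> below
      is the right block at the same scale.\<close>
    define L where "L = (\<lambda>n. dilation (b n / b (m n)) (S (m n)))"
    have L: "real_distribution (L n)" for n unfolding L_def by (rule real_distribution_dilation[OF S])
    have bb: "b n / b (m n) > 0" for n using b by simp
    define Q where "Q = (\<lambda>n \<kappa>. real_distribution \<kappa> \<and> (\<forall>z. Im z > 0 \<longrightarrow> F_transform (P n) z
        = F_transform (P (m n)) (F_transform \<kappa> z)))"
    have "\<exists>\<kappa>. Q n \<kappa>" for n
      unfolding Q_def P_def by (rule monotone_conv_upto_tail[of \<nu>, OF _ m(1)]) (rule \<nu>)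
    then obtain \<kappa> where "\<And>n. Q n (\<kappa> n)" by metis
    then have \<kappa>: "\<And>n. real_distribution (\<kappa> n)"
      "\<And>n z. Im z > 0 \<Longrightarrow> F_transform (P n) z = F_transform (P (m n)) (F_transform (\<kappa> n) z)"
      by (auto simp: Q_def)
    define N where "N = (\<lambda>n. dilation (b n) (\<kappa> n))"
    have N: "real_distribution (N n)" for n unfolding N_def by (rule real_distribution_dilation[OF \<kappa>(1)])
    have comp: "F_transform (S n) z = F_transform (L n) (F_transform (N n) z)" if z: "Im z > 0" for n z
    proof -
      have "F_transform (L n) (F_transform (N n) z) = complex_of_real (b n) *
          F_transform (P (m n)) (F_transform (\<kappa> n) (z / complex_of_real (b n)))"
        unfolding L_def F_transform_dilation[OF S bb] FS N_def F_transform_dilation[OF \<kappa>(1) b]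
        using b[of n] b[of "m n"] by simp
      then show ?thesis unfolding FS using \<kappa>(2)[OF Im_div[OF z b]] by simp
    qed
    have D: "real_distribution (dilation c \<mu>)" by (rule real_distribution_dilation[OF \<mu>])
    have lim_L: "(\<lambda>n. cauchy_transform (L n) z) \<longlonglongrightarrow> cauchy_transform (dilation c \<mu>) z" if z: "Im z > 0" for z
      unfolding L_def cauchy_transform_dilation[OF S bb] cauchy_transform_dilation[OF \<mu> c(1)]
    proof (intro tendsto_divide)
      show "(\<lambda>n. complex_of_real (b n / b (m n))) \<longlonglongrightarrow> complex_of_real c" by (rule tendsto_of_real[OF m(3)])
      have zc: "Im (z / complex_of_real c) > 0" by (rule Im_div[OF z c(1)])
      show "(\<lambda>n. cauchy_transform (S (m n)) (z / complex_of_real (b n / b (m n))))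
        \<longlonglongrightarrow> cauchy_transform \<mu> (z / complex_of_real c)"
      proof (rule cauchy_transform_tendsto_compose[OF S zc filterlim_compose[OF lim[OF zc] m(2)]])
        show "(\<lambda>n. z / complex_of_real (b n / b (m n))) \<longlonglongrightarrow> z / complex_of_real c"
          using c by (intro tendsto_divide tendsto_const tendsto_of_real m(3)) auto
      qed
    qed (use c in auto)
    have tails_L: "\<exists>K>0. \<forall>\<^sub>F n in sequentially. measure (L n) {x. K < \<bar>x\<bar>} \<le> e" if "e > 0" for e
      by (rule cauchy_transform_limit_tails[OF L lim_L real_distribution.ii_cauchy_transform_tendsto_1[OF D] that])
    have "tight N"
      by (rule tightI_tails[OF N right_factor_tails[OF S L N \<mu> comp lim tails_L]])
    then obtain r \<rho> where r: "strict_mono r" and \<rho>: "real_distribution \<rho>" "weak_conv_m (N \<circ> id \<circ> r) \<rho>"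
      using tight_imp_convergent_subsubsequence[of N id] by (auto simp: strict_mono_id)
    \<comment> \<open>One subsequential limit of the right blocks is enough, because
      \<open>S\<close> and \<open>L\<close> converge along the full sequence.\<close>
    have "\<mu> = dilation c \<mu> \<rhd> \<rho>"
    proof (rule monotone_conv_spec(3)[OF D \<rho>(1) \<mu>])
      fix z :: complex assume z: "Im z > 0"
      have Im_\<rho>: "Im (F_transform \<rho> z) > 0" by (rule real_distribution.Im_F_transform_pos[OF \<rho>(1) z])
      have "(\<lambda>n. cauchy_transform ((N \<circ> id \<circ> r) n) z) \<longlonglongrightarrow> cauchy_transform \<rho> z"
        using N by (intro weak_conv_m_imp_cauchy_transform \<rho> z) auto
      from F_transform_tendsto[OF \<rho>(1) z this]
      have FN: "(\<lambda>n. F_transform (N (r n)) z) \<longlonglongrightarrow> F_transform \<rho> z" by simp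
      have LF: "(\<lambda>n. cauchy_transform (L (r n)) (F_transform \<rho> z)) \<longlonglongrightarrow> cauchy_transform (dilation c \<mu>) (F_transform \<rho> z)"
        using LIMSEQ_subseq_LIMSEQ[OF lim_L[OF Im_\<rho>] r] by (simp add: o_def)
      have "(\<lambda>n. cauchy_transform (L (r n)) (F_transform (N (r n)) z))
        \<longlonglongrightarrow> cauchy_transform (dilation c \<mu>) (F_transform \<rho> z)"
        by (rule cauchy_transform_tendsto_compose[of "\<lambda>n. L (r n)", OF L Im_\<rho> LF FN])
      moreover have "cauchy_transform (L (r n)) (F_transform (N (r n)) z) = cauchy_transform (S (r n)) z" for n
        using comp[OF z, of "r n"] by (simp add: F_transform_def)
      ultimately have "(\<lambda>n. cauchy_transform (S (r n)) z) \<longlonglongrightarrow> cauchy_transform (dilation c \<mu>) (F_transform \<rho> z)"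
        by simp
      moreover have "(\<lambda>n. cauchy_transform (S (r n)) z) \<longlonglongrightarrow> cauchy_transform \<mu> z"
        using LIMSEQ_subseq_LIMSEQ[OF lim[OF z] r] by (simp add: o_def)
      ultimately have "cauchy_transform \<mu> z = cauchy_transform (dilation c \<mu>) (F_transform \<rho> z)"
        by (rule LIMSEQ_unique[symmetric])
      then show "F_transform \<mu> z = F_transform (dilation c \<mu>) (F_transform \<rho> z)"
        by (simp add: F_transform_def)
    qed
    then show "\<exists>\<rho>. real_distribution \<rho> \<and> \<mu> = dilation c \<mu> \<rhd> \<rho>" using \<rho>(1) by blast
  qed
qed

subsection \<open>Selfdecomposable measures are limit laws\<close>

text \<open>At u = iy and w = F_N(u), the factorisation says that G of the dilated law at
  \<open>w\<close> equals G_\<mu>(u). As the dilated laws tend to \<mu>, G of the dilated law takes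
  nearly equal values at \<open>w\<close> and \<open>u\<close>, and the lower bound on its
  difference quotient forces w to u. One height suffices for every \<open>d\<close>.\<close>

lemma right_factor_tendsto_identity:
  assumes \<mu>: "real_distribution \<mu>" and c: "\<And>n. 0 < c n" "\<And>n. c n \<le> 1" "c \<longlonglongrightarrow> 1"
    and N: "\<And>n. real_distribution (N n)"
    and comp: "\<And>n z. Im z > 0 \<Longrightarrow> F_transform \<mu> z = F_transform (dilation (c n) \<mu>) (F_transform (N n) z)"
    and d: "d > 0"
  shows "(\<lambda>n. measure (N n) {x. d < \<bar>x\<bar>}) \<longlonglongrightarrow> 0"
proof -
  interpret \<mu>: real_distribution \<mu> by fact
  define L where "L = (\<lambda>n. dilation (c n) \<mu>)"
  have L: "real_distribution (L n)" for n unfolding L_def by (rule real_distribution_dilation[OF \<mu>])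
  \<comment> \<open>A fixed accuracy: it only has to bring \<open>w n\<close> close enough to
    \<open>u\<close> for the difference quotient estimate to apply.\<close>
  define e :: real where "e = 1 / 12"
  have e: "0 < e" "e \<le> 1 / 12" by (auto simp: e_def)
  obtain K where K: "K > 0" "measure \<mu> {x. K < \<bar>x\<bar>} \<le> e" using \<mu>.exists_tail_le[OF e(1)] by blast
  have tail: "measure (L n) {x. K < \<bar>x\<bar>} \<le> e" for n
  proof -
    have "\<bar>c n * x\<bar> \<le> \<bar>x\<bar>" for x
      using c(1)[of n] c(2)[of n] by (simp add: abs_mult mult_left_le_one_le)
    then have "measure \<mu> {x. K < \<bar>c n * x\<bar>} \<le> measure \<mu> {x. K < \<bar>x\<bar>}"
      by (intro \<mu>.finite_measure_mono) (auto intro: less_le_trans)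
    then show ?thesis using K(2) by (simp add: L_def measure_dilation_tail[OF \<mu>])
  qed
  have "\<exists>y>0. K \<le> e * y \<and> (\<forall>\<^sub>F n in sequentially.
    norm (F_transform (N n) (\<i> * complex_of_real y) / (\<i> * complex_of_real y) - 1) \<le> 6 * e)"
    by (rule right_factor_near_identity[of "\<lambda>_. \<mu>" L N \<mu> e K])
      (use \<mu> L N comp e K tail in \<open>auto simp: L_def\<close>)
  then obtain y where y: "y > 0" "K \<le> e * y" and near: "\<forall>\<^sub>F n in sequentially.
      norm (F_transform (N n) (\<i> * complex_of_real y) / (\<i> * complex_of_real y) - 1) \<le> 6 * e"
    by blast
  define u where "u = \<i> * complex_of_real y"
  define w where "w = (\<lambda>n. F_transform (N n) u)"
  define D where "D = (\<lambda>n. cauchy_transform \<mu> u - cauchy_transform (L n) u)"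
  have u: "Im u > 0" "Im u = y" "norm u = y" "u \<noteq> 0" using y by (auto simp: u_def norm_mult)
  \<comment> \<open>With \<open>D n = (u - w n) * I\<close> and |w u I| \<ge> 1/2, one gets |w - u|
    / 2 \<le> |w| y |D|, and |w| \<le> 2 y gives the factor 4 y^2.\<close>
  have bound: "\<forall>\<^sub>F n in sequentially. norm (w n - u) \<le> 4 * y\<^sup>2 * norm (D n)"
    using near
  proof eventually_elim
    case (elim n)
    interpret L: real_distribution "L n" by (rule L)
    have w: "Im (w n) \<ge> y" unfolding w_def using real_distribution.Im_F_transform_ge[OF N u(1)] u by simp
    have "norm (w n / u) \<le> 1 + 1 / 2"
      using elim norm_triangle_ineq[of "w n / u - 1" 1] by (simp add: w_def u_def e_def)
    then have w2: "norm (w n) \<le> 2 * y" using u y by (simp add: norm_divide field_simps)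
    define I where "I = (\<integral>x. 1 / ((w n - complex_of_real x) * (u - complex_of_real x)) \<partial>L n)"
    have "norm (w n * u * I - 1) \<le> 1 / 2"
      unfolding I_def
      by (rule L.cauchy_kernel_prod_estimate[OF e y(1) less_imp_le[OF K(1)] y(2) tail w w2 u(2,3)])
    then have I: "1 / 2 \<le> norm (w n * u * I)"
      using norm_triangle_ineq2[of 1 "1 - w n * u * I"] by (simp add: norm_minus_commute)
    have "cauchy_transform (L n) (w n) = cauchy_transform \<mu> u"
      using comp[OF u(1), of n] by (simp add: w_def L_def F_transform_def)
    then have D: "D n = (u - w n) * I"
      unfolding D_def I_def using L.cauchy_transform_diff[of u "w n"] u w y(1) by simp
    have "norm (w n - u) * (1 / 2) \<le> norm (w n - u) * norm (w n * u * I)"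
      using I by (intro mult_left_mono) auto
    also have "\<dots> = norm (w n) * y * norm (D n)"
      unfolding D norm_mult u(3) by (simp add: norm_minus_commute)
    also have "\<dots> \<le> 2 * y * y * norm (D n)"
      using w2 y by (intro mult_right_mono) auto
    finally show ?case by (simp add: power2_eq_square)
  qed
  have "(\<lambda>n. cauchy_transform \<mu> (u / complex_of_real (c n)) / complex_of_real (c n))
    \<longlonglongrightarrow> cauchy_transform \<mu> u / complex_of_real 1"
  proof (intro tendsto_divide tendsto_of_real c(3))
    show "(\<lambda>n. cauchy_transform \<mu> (u / complex_of_real (c n))) \<longlonglongrightarrow> cauchy_transform \<mu> u"
    proof (rule cauchy_transform_tendsto_compose[OF \<mu> u(1) tendsto_const])
      have "(\<lambda>n. u / complex_of_real (c n)) \<longlonglongrightarrow> u / complex_of_real 1"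
        by (intro tendsto_divide tendsto_const tendsto_of_real c(3)) simp
      then show "(\<lambda>n. u / complex_of_real (c n)) \<longlonglongrightarrow> u" by simp
    qed
  qed simp
  then have "(\<lambda>n. cauchy_transform (L n) u) \<longlonglongrightarrow> cauchy_transform \<mu> u"
    by (simp add: L_def cauchy_transform_dilation[OF \<mu> c(1)])
  then have "(\<lambda>n. 4 * y\<^sup>2 * norm (D n)) \<longlonglongrightarrow> 4 * y\<^sup>2 * norm (cauchy_transform \<mu> u - cauchy_transform \<mu> u)"
    unfolding D_def by (intro tendsto_mult_left tendsto_norm tendsto_diff tendsto_const)
  then have "(\<lambda>n. 4 * y\<^sup>2 * norm (D n)) \<longlonglongrightarrow> 0" by simp
  from tendsto_add[OF Lim_null_comparison[OF bound this] tendsto_const[of u]]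
  have w_lim: "w \<longlonglongrightarrow> u" by simp
  have uG: "u * cauchy_transform (N n) u = u / w n" for n by (simp add: w_def F_transform_def)
  have "(\<lambda>n. (1 + y\<^sup>2 / d\<^sup>2) * (1 - Re (u / w n))) \<longlonglongrightarrow> (1 + y\<^sup>2 / d\<^sup>2) * (1 - Re (u / u))"
    using u by (intro tendsto_mult_left tendsto_diff tendsto_const tendsto_Re tendsto_divide w_lim) auto
  then have "(\<lambda>n. (1 + y\<^sup>2 / d\<^sup>2) * (1 - Re (u / w n))) \<longlonglongrightarrow> 0" using u by simp
  then show ?thesis
  proof (rule tendsto_sandwich[OF _ _ tendsto_const, rotated 2])
    show "\<forall>\<^sub>F n in sequentially. measure (N n) {x. d < \<bar>x\<bar>} \<le> (1 + y\<^sup>2 / d\<^sup>2) * (1 - Re (u / w n))"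
      using real_distribution.measure_tail_le[OF N y(1) d] unfolding u_def[symmetric] uG by simp
  qed simp
qed

text \<open>Entries with large \<open>k\<close> are small because \<open>N k\<close> already is and
  k / n \<le> 1; the finitely many others are small because k / n tends to 0.\<close>

lemma infinitesimal_array_dilations:
  assumes N: "\<And>n. n \<ge> 1 \<Longrightarrow> real_distribution (N n)"
    and tail: "\<And>d. d > 0 \<Longrightarrow> (\<lambda>n. measure (N n) {x. d < \<bar>x\<bar>}) \<longlonglongrightarrow> 0"
  shows "infinitesimal_array (\<lambda>n. n) (\<lambda>n k. dilation (real k / real n) (N k))"
  unfolding infinitesimal_array_def
proof (intro conjI allI impI ballI)
  show "filterlim (\<lambda>n::nat. n) at_top sequentially" by (rule filterlim_ident)
  show "real_distribution (dilation (real j / real n) (N j))" if "j \<in> {1..n}" for n j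
    using that by (intro real_distribution_dilation N) auto
  fix d :: real assume d: "d > 0"
  show "(\<lambda>n. SUP j\<in>{1..n}. measure (dilation (real j / real n) (N j)) (UNIV - {-d..d})) \<longlonglongrightarrow> 0"
  proof (rule tendstoI)
    fix e :: real assume e: "e > 0"
    obtain n0 where n0: "\<And>k. k \<ge> n0 \<Longrightarrow> measure (N k) {x. d < \<bar>x\<bar>} < e / 2"
      using order_tendstoD(2)[OF tail[OF d], of "e / 2"] e by (auto simp: eventually_sequentially)
    have "\<exists>K>0. k \<ge> 1 \<longrightarrow> measure (N k) {x. K < \<bar>x\<bar>} \<le> e / 2" for k
      using real_distribution.exists_tail_le[OF N[of k], of "e / 2"] e by (cases "k \<ge> 1") auto
    then obtain K where K: "\<And>k. K k > 0" "\<And>k. k \<ge> 1 \<Longrightarrow> measure (N k) {x. K k < \<bar>x\<bar>} \<le> e / 2"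
      by metis
    \<comment> \<open>Dominates every k K_k with k < n0; n \<ge> B / d then moves the cut-off of
      each such entry inside [-d, d].\<close>
    define B where "B = (\<Sum>k<n0. real k * K k)"
    have "\<forall>\<^sub>F n in sequentially. real n \<ge> B / d"
      using filterlim_real_sequentially unfolding filterlim_at_top by blast
    with eventually_ge_at_top[of 1]
    show "\<forall>\<^sub>F n in sequentially.
      dist (SUP j\<in>{1..n}. measure (dilation (real j / real n) (N j)) (UNIV - {-d..d})) 0 < e"
    proof eventually_elim
      case (elim n)
      have le: "measure (dilation (real j / real n) (N j)) (UNIV - {-d..d}) \<le> e / 2" if j: "j \<in> {1..n}" for j
      proof -
        have j1: "j \<ge> 1" using j by simp
        interpret Nj: real_distribution "N j" by (rule N[OF j1])
        have eq: "measure (dilation (real j / real n) (N j)) (UNIV - {-d..d})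
            = measure (N j) {x. d < \<bar>real j / real n * x\<bar>}"
          unfolding tail_set_eq by (rule measure_dilation_tail[OF N[OF j1]])
        show ?thesis
        proof (cases "j \<ge> n0")
          case True
          have "\<bar>real j / real n * x\<bar> \<le> 1 * \<bar>x\<bar>" for x
            unfolding abs_mult using j by (intro mult_right_mono) auto
          then have "measure (N j) {x. d < \<bar>real j / real n * x\<bar>} \<le> measure (N j) {x. d < \<bar>x\<bar>}"
            by (intro Nj.finite_measure_mono) (auto intro: less_le_trans)
          then show ?thesis unfolding eq using n0[OF True] by simp
        next
          case False
          have "real j * K j \<le> B"
            unfolding B_def using False K(1) by (intro member_le_sum) (auto simp: less_imp_le)
          also have "B \<le> real n * d" using elim d by (simp add: field_simps)
          finally have jK: "real j * K j \<le> real n * d" .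
          have "K j < \<bar>x\<bar>" if "d < \<bar>real j / real n * x\<bar>" for x
          proof -
            have "real n * d < real j * \<bar>x\<bar>" using that elim by (simp add: abs_mult field_simps)
            with jK have "real j * K j < real j * \<bar>x\<bar>" by simp
            then show ?thesis using j1 by simp
          qed
          then have "measure (N j) {x. d < \<bar>real j / real n * x\<bar>} \<le> measure (N j) {x. K j < \<bar>x\<bar>}"
            by (intro Nj.finite_measure_mono) auto
          then show ?thesis unfolding eq using K(2)[OF j1] by simp
        qed
      qed
      have ne: "{1..n} \<noteq> {}" using elim by simp
      have "(SUP j\<in>{1..n}. measure (dilation (real j / real n) (N j)) (UNIV - {-d..d})) \<le> e / 2"
        by (rule cSUP_least[OF ne le])
      moreover have "0 \<le> (SUP j\<in>{1..n}. measure (dilation (real j / real n) (N j)) (UNIV - {-d..d}))"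
        using elim by (intro cSUP_upper2[of _ _ 1]) (auto intro: bdd_above_finite)
      ultimately show ?case using e by (simp add: dist_real_def)
    qed
  qed
qed

text \<open>The rescaled convolutions do not merely converge to \<mu>: each of them equals \<mu>, so
  only infinitesimality of the array needs analysis.\<close>

theorem monotonically_selfdecomposable_imp_limit:
  assumes "monotonically_selfdecomposable \<mu>"
  obtains \<nu> where "\<And>n. n \<ge> 1 \<Longrightarrow> real_distribution (\<nu> n)"
    "infinitesimal_array (\<lambda>n. n) (\<lambda>n k. dilation (1 / real n) (\<nu> k))"
    "\<And>n. n \<ge> 1 \<Longrightarrow> dilation (1 / real n) (monotone_conv_upto \<nu> n) = \<mu>"
proof -
  have \<mu>: "real_distribution \<mu>" using assms by (simp add: monotonically_selfdecomposable_def)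
  have "\<exists>\<kappa>. real_distribution \<kappa> \<and> (n \<ge> 1 \<longrightarrow> \<mu> = dilation (real n / real (Suc n)) \<mu> \<rhd> \<kappa>)" for n
  proof (cases "n \<ge> 1")
    case True
    then have "0 < real n / real (Suc n) \<and> real n / real (Suc n) < 1" by simp
    then show ?thesis using assms unfolding monotonically_selfdecomposable_def by blast
  qed (use \<mu> in auto)
  then obtain \<kappa> where \<kappa>: "\<And>n. real_distribution (\<kappa> n)"
    "\<And>n. n \<ge> 1 \<Longrightarrow> \<mu> = dilation (real n / real (Suc n)) \<mu> \<rhd> \<kappa> n" by metis
  \<comment> \<open>The index shift: \<open>\<kappa> n\<close> belongs to the ratio n / (n + 1), so
    \<open>N n\<close> belongs to (n - 1) / n. The first factor has no predecessor and is \<mu>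
    itself.\<close>
  define N where "N = (\<lambda>n. if n \<le> 1 then \<mu> else \<kappa> (n - 1))"
  have N: "real_distribution (N n)" for n using \<mu> \<kappa>(1) by (simp add: N_def)
  define \<nu> where "\<nu> = (\<lambda>n. dilation (real n) (N n))"
  have \<nu>: "real_distribution (\<nu> n)" for n unfolding \<nu>_def by (rule real_distribution_dilation[OF N])
  have comp: "F_transform \<mu> z = F_transform (dilation (real n / real (Suc n)) \<mu>) (F_transform (\<kappa> n) z)"
    if "n \<ge> 1" "Im z > 0" for n z
    using monotone_conv_spec(2)[OF real_distribution_dilation[OF \<mu>] \<kappa>(1) that(2)] \<kappa>(2)[OF that(1)] by metis
  have upto: "monotone_conv_upto \<nu> (Suc n) = dilation (real (Suc n)) \<mu>" for n
  proof (induction n)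
    case 0
    show ?case by (simp add: \<nu>_def N_def)
  next
    case (Suc n)
    let ?m = "Suc n"
    have "monotone_conv_upto \<nu> (Suc ?m) = dilation (real ?m) \<mu> \<rhd> \<nu> (Suc ?m)"
      using Suc by simp
    \<comment> \<open>The factorisation of \<mu> with ratio m / (m + 1), dilated by m + 1: dilating
      both factors of a monotone convolution dilates the result.\<close>
    also have "\<dots> = dilation (real (Suc ?m)) \<mu>"
    proof (rule monotone_conv_spec(3)[symmetric, OF real_distribution_dilation[OF \<mu>] \<nu> real_distribution_dilation[OF \<mu>]])
      fix z :: complex assume z: "Im z > 0"
      let ?z = "z / complex_of_real (real (Suc ?m))"
      have pos: "real ?m > 0" "real (Suc ?m) > 0" "real ?m / real (Suc ?m) > 0" by auto
      have "Im ?z > 0" using z by (simp del: of_nat_Suc)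
      have "F_transform (dilation (real (Suc ?m)) \<mu>) z = complex_of_real (real (Suc ?m)) * F_transform \<mu> ?z"
        by (rule F_transform_dilation[OF \<mu> pos(2)])
      also have "F_transform \<mu> ?z = complex_of_real (real ?m / real (Suc ?m)) *
          F_transform \<mu> (F_transform (\<kappa> ?m) ?z / complex_of_real (real ?m / real (Suc ?m)))"
        using comp[OF _ \<open>Im ?z > 0\<close>, of ?m] unfolding F_transform_dilation[OF \<mu> pos(3)] by simp
      also have "complex_of_real (real (Suc ?m)) * \<dots>
          = complex_of_real (real ?m) * F_transform \<mu> (complex_of_real (real (Suc ?m)) * F_transform (\<kappa> ?m) ?z / complex_of_real (real ?m))"
        using pos by (simp del: of_nat_Suc add: mult.commute)
      also have "\<dots> = F_transform (dilation (real ?m) \<mu>) (F_transform (\<nu> (Suc ?m)) z)"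
        unfolding \<nu>_def F_transform_dilation[OF N pos(2)] F_transform_dilation[OF \<mu> pos(1)] by (simp add: N_def)
      finally show "F_transform (dilation (real (Suc ?m)) \<mu>) z
        = F_transform (dilation (real ?m) \<mu>) (F_transform (\<nu> (Suc ?m)) z)" .
    qed
    finally show ?case .
  qed
  have tail: "(\<lambda>n. measure (N n) {x. d < \<bar>x\<bar>}) \<longlonglongrightarrow> 0" if "d > 0" for d
  proof -
    have "(\<lambda>n. measure (\<kappa> (Suc n)) {x. d < \<bar>x\<bar>}) \<longlonglongrightarrow> 0"
    proof (rule right_factor_tendsto_identity[OF \<mu> _ _ _ \<kappa>(1) _ that])
      show "F_transform \<mu> z = F_transform (dilation (real (Suc n) / real (Suc (Suc n))) \<mu>) (F_transform (\<kappa> (Suc n)) z)"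
        if "Im z > 0" for n z by (rule comp[OF _ that]) simp
      show "(\<lambda>n. real (Suc n) / real (Suc (Suc n))) \<longlonglongrightarrow> 1"
        using LIMSEQ_Suc[OF LIMSEQ_n_over_Suc_n] by simp
    qed auto
    then have "(\<lambda>n. measure (N (n + 2)) {x. d < \<bar>x\<bar>}) \<longlonglongrightarrow> 0" by (simp add: N_def)
    then show ?thesis by (rule LIMSEQ_offset)
  qed
  show ?thesis
  proof (rule that[of \<nu>])
    show "real_distribution (\<nu> n)" for n by (rule \<nu>)
    have "dilation (1 / real n) (\<nu> k) = dilation (real k / real n) (N k)" for n k
      unfolding \<nu>_def dilation_dilation[OF N] by simp
    then show "infinitesimal_array (\<lambda>n. n) (\<lambda>n k. dilation (1 / real n) (\<nu> k))"
      using infinitesimal_array_dilations[of N] N tail by simp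
    show "dilation (1 / real n) (monotone_conv_upto \<nu> n) = \<mu>" if "n \<ge> 1" for n
    proof -
      obtain m where n: "n = Suc m" using \<open>n \<ge> 1\<close> by (cases n) auto
      show ?thesis unfolding n upto dilation_dilation[OF \<mu>] by (simp add: dilation_1[OF \<mu>] del: of_nat_Suc)
    qed
  qed
qed

section \<open>The equivalence in terms of weak convergence\<close>

lemma weak_conv_m_cong:
  assumes "\<forall>\<^sub>F n in sequentially. M n = N n"
  shows "weak_conv_m M \<mu> \<longleftrightarrow> weak_conv_m N \<mu>"
  unfolding weak_conv_m_def weak_conv_def
  by (intro all_cong tendsto_cong eventually_mono[OF assms]) simp

lemma weak_conv_m_const: "weak_conv_m (\<lambda>_. \<mu>) \<mu>"
  by (simp add: weak_conv_m_def weak_conv_def)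

lemma infinitesimal_array_cong:
  assumes "\<And>n j. n \<ge> 1 \<Longrightarrow> M n j = N n j"
  shows "infinitesimal_array k M \<longleftrightarrow> infinitesimal_array k N"
proof -
  have "\<forall>\<^sub>F n in sequentially. (SUP j\<in>{1..k n}. measure (M n j) A) = (SUP j\<in>{1..k n}. measure (N n j) A)" for A
    using eventually_ge_at_top[of 1] by eventually_elim (simp add: assms)
  from tendsto_cong[OF this] show ?thesis using assms by (simp add: infinitesimal_array_def)
qed

theorem theorem1p22:
  fixes \<mu> :: "real measure"
  assumes "real_distribution \<mu>"
  shows "(\<exists>(b :: nat \<Rightarrow> real) (\<nu> :: nat \<Rightarrow> real measure).
            (\<forall>n\<ge>1. b n > 0) \<and>
            (\<forall>n\<ge>1. real_distribution (\<nu> n)) \<and>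
            infinitesimal_array (\<lambda>n. n) (\<lambda>n k. dilation (b n) (\<nu> k)) \<and>
            weak_conv_m (\<lambda>n. dilation (b n) (monotone_conv_upto \<nu> n)) \<mu>)
         \<longleftrightarrow> monotonically_selfdecomposable \<mu>"
    (is "?L \<longleftrightarrow> ?R")
proof
  assume ?L
  then obtain b \<nu> where b: "\<forall>n\<ge>1. b n > (0::real)" and \<nu>: "\<forall>n\<ge>1. real_distribution (\<nu> n)"
    and inf: "infinitesimal_array (\<lambda>n. n) (\<lambda>n k. dilation (b n) (\<nu> k))"
    and conv: "weak_conv_m (\<lambda>n. dilation (b n) (monotone_conv_upto \<nu> n)) \<mu>"
    by blast
  \<comment> \<open>Positivity of \<open>b\<close> is given from index 1 on, whereas the implication
    proved above asks for it at every index; only the value at 0 is changed.\<close>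
  define b' where "b' = b(0 := 1)"
  have eq: "b' n = b n" if "n \<ge> 1" for n using that by (simp add: b'_def)
  show ?R
  proof (rule limit_imp_monotonically_selfdecomposable[OF assms, of b' \<nu>])
    show "b' n > 0" for n using b by (simp add: b'_def)
    show "real_distribution (\<nu> n)" if "n \<ge> 1" for n using \<nu> that by blast
    show "infinitesimal_array (\<lambda>n. n) (\<lambda>n k. dilation (b' n) (\<nu> k))"
      using inf infinitesimal_array_cong[of "\<lambda>n k. dilation (b' n) (\<nu> k)" "\<lambda>n k. dilation (b n) (\<nu> k)"] eq by simp
    have ev: "\<forall>\<^sub>F n in sequentially. dilation (b' n) (monotone_conv_upto \<nu> n) = dilation (b n) (monotone_conv_upto \<nu> n)"
      using eventually_ge_at_top[of 1] by eventually_elim (simp add: eq)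
    show "weak_conv_m (\<lambda>n. dilation (b' n) (monotone_conv_upto \<nu> n)) \<mu>"
      by (rule iffD2[OF weak_conv_m_cong[OF ev] conv])
  qed
next
  assume ?R
  then obtain \<nu> where \<nu>: "\<And>n. n \<ge> 1 \<Longrightarrow> real_distribution (\<nu> n)"
    "infinitesimal_array (\<lambda>n. n) (\<lambda>n k. dilation (1 / real n) (\<nu> k))"
    "\<And>n. n \<ge> 1 \<Longrightarrow> dilation (1 / real n) (monotone_conv_upto \<nu> n) = \<mu>"
    using monotonically_selfdecomposable_imp_limit by blast
  have ev: "\<forall>\<^sub>F n in sequentially. dilation (1 / real n) (monotone_conv_upto \<nu> n) = \<mu>"
    using eventually_ge_at_top[of 1] by eventually_elim (rule \<nu>(3))
  have "weak_conv_m (\<lambda>n. dilation (1 / real n) (monotone_conv_upto \<nu> n)) \<mu>"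
    by (rule iffD2[OF weak_conv_m_cong[OF ev] weak_conv_m_const])
  then show ?L
    using \<nu> by (intro exI[of _ "\<lambda>n. 1 / real n"] exI[of _ \<nu>]) auto
qed

end
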